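(* Under the setting described in the context, the integral $I(z)$ has the asymptotic expansion \[ I(z) \sim \sum_{n\geq 0} A_n z^{-n} \] as $z\to\infty$, with the coefficients $A_n$ given by \[ A_n = \sum_{G \in \mathcal{G}^\star_{-n}} \frac{1}{\lvert \mathrm{Aut}(G) \rvert} \prod_{v\in V^G} \Lambda_{\deg(v)}, \] where $\mathcal{G}^\star_{-n}$ is the set of (isomorphism classes of) all edge-bicolored graphs with all vertex degrees at least $3$ and Euler characteristic equal to $-n$.
   Context: Let $D\subseteq\mathbb{R}^2$ and $g:D\to\mathbb{R}$, and for $z>0$ set $I(z) = \frac{z}{2\pi}\int_D \exp(z\, g(x,y))\,\mathrm{d}x\,\mathrm{d}y$. Assume: (1) $I(z)$ exists for $z>0$; (2) $D$ contains a neighborhood of the origin; (3) $g$ attains its unique supremum over $D$ at the origin; (4) near the origin $g$ has a convergent expansion $g(x,y) = -\frac{x^2}{2} - \frac{y^2}{2} + \sum_{u,w\ge 0,\ u+w\ge 3} \Lambda_{u,w}\frac{x^u y^w}{u!\,w!}$. The asymptotic notation $f(z)\sim\sum_{n\ge0} g_n(z)$ means $f(z)-\sum_{n=0}^{R-1}g_n(z)\in\mathcal{O}(g_R(z))$ for all $R\ge0$. An edge-bicolored graph is represented, for disjoint finite label sets $S$ (red half-edges) and $T$ (yellow half-edges), by a triple $(V,E_S,E_T)$ where $V$ is a set partition of $S\sqcup T$ (the vertices), $E_S$ is a partition of $S$ into blocks of size 2 (red edges) and $E_T$ a partition of $T$ into blocks of size 2 (yellow edges). Isomorphisms are pairs of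 bijections $S_1\to S_2$, $T_1\to T_2$ carrying $V,E_S,E_T$ to the corresponding partitions; $\mathrm{Aut}(G)$ is the automorphism group of a representative. For a graph $G$, $V^G$ is its vertex set and $E^G=E_S^G\sqcup E_T^G$ its edge set; the Euler characteristic is $\chi(G)=|V^G|-|E^G|$. The bidegree $\deg(v)=(u,w)$ of a vertex $v$ records the number $u$ of red half-edges and $w$ of yellow half-edges in $v$; the vertex degree is $u+w$.
   Formalization: Remainders are O(z^{-R}), not O(A_R z^{-R}), which fails when A_R=0 (unit disc, g=-(x²+y²)/2); "unique supremum at the origin" means g is bounded by a constant below g(0) off every neighborhood of the origin, since g<g(0) pointwise does not suffice. *)

theory Defs
  imports "HOL-Analysis.Analysis" "HOL-Library.Landau_Symbols" "HOL-Library.Disjoint_Sets"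
begin

section \<open>Edge-bicolored graphs\<close>

text \<open>The label sets \<open>S\<close> and \<open>T\<close> of red and yellow half-edges are not stored, as the edge
  partitions determine them.\<close>

record 'a bigraph =
  verts :: "'a set set"
  red_edges :: "'a set set"
  yellow_edges :: "'a set set"

definition red_halves :: "'a bigraph \<Rightarrow> 'a set" where
  "red_halves G = \<Union> (red_edges G)"

definition yellow_halves :: "'a bigraph \<Rightarrow> 'a set" where
  "yellow_halves G = \<Union> (yellow_edges G)"

definition edge_bicolored_graph_on :: "'a set \<Rightarrow> 'a set \<Rightarrow> 'a bigraph \<Rightarrow> bool" where
  "edge_bicolored_graph_on S T G \<longleftrightarrow>
     finite S \<and> finite T \<and> S \<inter> T = {} \<and>
     partition_on (S \<union> T) (verts G) \<and>
     partition_on S (red_edges G) \<and> (\<forall>e\<in>red_edges G. card e = 2) \<and>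
     partition_on T (yellow_edges G) \<and> (\<forall>e\<in>yellow_edges G. card e = 2)"

definition edge_bicolored_graph :: "'a bigraph \<Rightarrow> bool" where
  "edge_bicolored_graph G \<longleftrightarrow> (\<exists>S T. edge_bicolored_graph_on S T G)"

lemma edge_bicolored_graph_on_halves:
  assumes "edge_bicolored_graph_on S T G"
  shows "red_halves G = S" and "yellow_halves G = T"
  using assms
  by (auto simp: edge_bicolored_graph_on_def red_halves_def yellow_halves_def partition_on_def)

definition edges :: "'a bigraph \<Rightarrow> 'a set set" where
  "edges G = red_edges G \<union> yellow_edges G"

definition euler_char :: "'a bigraph \<Rightarrow> int" where
  "euler_char G = int (card (verts G)) - int (card (edges G))"

definition bidegree :: "'a bigraph \<Rightarrow> 'a set \<Rightarrow> nat \<times> nat" where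
  "bidegree G v = (card (v \<inter> red_halves G), card (v \<inter> yellow_halves G))"

definition vertex_degree :: "'a bigraph \<Rightarrow> 'a set \<Rightarrow> nat" where
  "vertex_degree G v = fst (bidegree G v) + snd (bidegree G v)"

text \<open>The two bijections are taken to be extensional (\<open>undefined\<close> off their domains), so that
  distinct elements of \<open>graph_isos G H\<close> are distinct isomorphisms and the cardinality of
  \<open>graph_auts G\<close> is the order of the automorphism group.\<close>

definition graph_isos :: "'a bigraph \<Rightarrow> 'b bigraph \<Rightarrow> (('a \<Rightarrow> 'b) \<times> ('a \<Rightarrow> 'b)) set" where
  "graph_isos G H = {(j, k).
     j \<in> extensional (red_halves G) \<and> bij_betw j (red_halves G) (red_halves H) \<and>
     k \<in> extensional (yellow_halves G) \<and> bij_betw k (yellow_halves G) (yellow_halves H) \<and>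
     (\<lambda>v. j ` (v \<inter> red_halves G) \<union> k ` (v \<inter> yellow_halves G)) ` verts G = verts H \<and>
     (\<lambda>e. j ` e) ` red_edges G = red_edges H \<and>
     (\<lambda>e. k ` e) ` yellow_edges G = yellow_edges H}"

definition graph_auts :: "'a bigraph \<Rightarrow> (('a \<Rightarrow> 'a) \<times> ('a \<Rightarrow> 'a)) set" where
  "graph_auts G = graph_isos G G"

definition graph_iso_rel :: "('a bigraph \<times> 'a bigraph) set" where
  "graph_iso_rel =
     {(G, H). edge_bicolored_graph G \<and> edge_bicolored_graph H \<and> graph_isos G H \<noteq> {}}"

text \<open>Isomorphism classes are formed among graphs with labels in \<^typ>\<open>nat\<close>; every finite
  edge-bicolored graph is isomorphic to one of these.\<close>

definition Gstar :: "int \<Rightarrow> nat bigraph set set" where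
  "Gstar c =
     {G. edge_bicolored_graph G \<and> (\<forall>v\<in>verts G. 3 \<le> vertex_degree G v) \<and> euler_char G = c}
       // graph_iso_rel"

definition graph_weight :: "(nat \<times> nat \<Rightarrow> real) \<Rightarrow> 'a bigraph \<Rightarrow> real" where
  "graph_weight \<Lambda> G = 1 / real (card (graph_auts G)) * (\<Prod>v\<in>verts G. \<Lambda> (bidegree G v))"

definition graph_coeff :: "(nat \<times> nat \<Rightarrow> real) \<Rightarrow> nat \<Rightarrow> real" where
  "graph_coeff \<Lambda> n = (\<Sum>C\<in>Gstar (- int n). graph_weight \<Lambda> (SOME G. G \<in> C))"


section \<open>The integral and its asymptotic expansion\<close>

definition laplace_integral :: "(real \<times> real) set \<Rightarrow> (real \<times> real \<Rightarrow> real) \<Rightarrow> real \<Rightarrow> real" where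
  "laplace_integral D g z = z / (2 * pi) * (LINT p:D|lebesgue. exp (z * g p))"

text \<open>\<open>g\<close> attains its supremum over \<open>D\<close> at \<open>a\<close>, and the supremum is approached nowhere else: off
  any neighbourhood of \<open>a\<close>, \<open>g\<close> is bounded by a constant below \<open>g a\<close>. Since neither compactness of
  \<open>D\<close> nor continuity of \<open>g\<close> is assumed, this is more than \<open>g p < g a\<close> for all other points \<open>p\<close>.
  The weaker condition does not suffice for Laplace's method: \<open>g\<close> could tend to \<open>g a\<close> at another
  point of \<open>D\<close> where it is discontinuous, or along thin parts of \<open>D\<close> going to infinity.\<close>

definition attains_unique_supremum_at ::
    "('a::topological_space \<Rightarrow> real) \<Rightarrow> 'a set \<Rightarrow> 'a \<Rightarrow> bool" where
  "attains_unique_supremum_at g D a \<longleftrightarrow>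
     a \<in> D \<and> (\<forall>U. open U \<longrightarrow> a \<in> U \<longrightarrow> (\<exists>c < g a. \<forall>p\<in>D - U. g p \<le> c))"

lemma attains_unique_supremum_at_less:
  fixes g :: "'a::t1_space \<Rightarrow> real"
  assumes "attains_unique_supremum_at g D a" "p \<in> D" "p \<noteq> a"
  shows "g p < g a"
proof -
  have "open (- {p})" "a \<in> - {p}" using assms by auto
  then obtain c where "c < g a" "\<forall>q\<in>D - (- {p}). g q \<le> c"
    using assms(1) unfolding attains_unique_supremum_at_def by blast
  then show ?thesis using assms(2) by force
qed

text \<open>\<open>f(z) \<sim> \<Sum>n. a\<^sub>n z\<^sup>-\<^sup>n\<close> as \<open>z \<rightarrow> \<infinity>\<close>. The remainder is compared with \<open>z\<^sup>-\<^sup>R\<close> rather than with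
  the term \<open>a\<^sub>R z\<^sup>-\<^sup>R\<close>, which makes a difference only if \<open>a\<^sub>R = 0\<close>; comparing with a vanishing term
  would require the partial sum to equal \<open>f\<close> exactly for large \<open>z\<close>.\<close>

definition has_asymptotic_expansion :: "(real \<Rightarrow> real) \<Rightarrow> (nat \<Rightarrow> real) \<Rightarrow> bool" where
  "has_asymptotic_expansion f a \<longleftrightarrow>
     (\<forall>R. (\<lambda>z. f z - (\<Sum>n<R. a n * z powi (- int n))) \<in> O[at_top](\<lambda>z. z powi (- int R)))"

lemma has_asymptotic_expansion_nonzero:
  assumes "has_asymptotic_expansion f a" and "a R \<noteq> 0"
  shows "(\<lambda>z. f z - (\<Sum>n<R. a n * z powi (- int n))) \<in> O[at_top](\<lambda>z. a R * z powi (- int R))"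
  using assms unfolding has_asymptotic_expansion_def by simp

end

theory Submission
  imports Defs "HOL-Probability.Distributions"
begin

text \<open>
  Near the origin write \<open>g = -\<bar>p\<bar>\<^sup>2/2 + h\<close> and let \<open>T\<close> be a Taylor polynomial of \<open>h\<close>. Up to an error of
  order \<open>z\<^sup>-\<^sup>R\<close>, the integrand may be replaced on the whole plane by the Gaussian times
  \<open>\<Sum>m<2R. (z T)\<^sup>m / m!\<close>: every error term is dominated by some \<open>z\<^sup>m \<bar>p\<bar>\<^sup>2\<^sup>k exp(-z\<bar>p\<bar>\<^sup>2/4)\<close> with
  \<open>k - m \<ge> R\<close>, or by \<open>exp(-(z - 1)\<delta>) exp(g)\<close> away from the origin. Expanding \<open>T\<^sup>m\<close> over families of
  \<open>m\<close> bidegrees and integrating, each family contributes the product of its Taylor coefficients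
  times Gaussian moments, which count perfect matchings of the red and of the yellow half-edges.

  Families are matched with graphs by orbit counting: the permutations of \<open>S\<close> and \<open>T\<close> act on the
  graphs with half-edge sets \<open>S\<close>, \<open>T\<close>, so \<open>1/\<bar>Aut G\<bar>\<close> is the number of labelled copies of \<open>G\<close> divided
  by \<open>\<bar>S\<bar>! \<bar>T\<bar>!\<close>, while a labelled graph is a pair of perfect matchings together with a set
  partition, i.e. with a map onto \<open>{..<m}\<close> up to the \<open>m!\<close> permutations of its values.
\<close>

section \<open>Perfect matchings\<close>

text \<open>A family of \<open>m\<close> bidegrees with \<open>U\<close> red and \<open>W\<close>
  yellow half-edges in total contributes to the power of \<open>z\<close> with exponent
  \<open>m - (U + W) / 2\<close>. This is vertices minus edges, which is why the Euler
  characteristic indexes the expansion. All degrees being at least 3 gives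
  \<open>3 * m \<le> U + W = 2 * (n + m)\<close> in order \<open>n\<close>, so
  \<open>m \<le> 2 * n\<close>, and a single degree is at most \<open>2 * n + 2\<close>. Hence
  \<open>A_n\<close> is a finite sum, and keeping fewer than \<open>2 * R\<close> factors of degree
  below \<open>2 * R + 2\<close> loses no term of order below \<open>R\<close>. The exponential
  series of \<open>z T\<close> is truncated before the integral is extended to the plane, because
  \<open>exp (z T)\<close> times the Gaussian need not be integrable there: \<open>T\<close> can be
  positive and grows faster than the quadratic form. A polynomial times the Gaussian always is
  integrable. Near the origin \<open>h\<close> and \<open>T\<close> are at most
  \<open>(norm p)\<^sup>2 / 4\<close> in absolute value, so each replacement costs half of the
  Gaussian exponent; this is where the 4 in the dominating functions comes from.\<close>

definition perfect_matchings :: "'a set \<Rightarrow> 'a set set set" where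
  "perfect_matchings S = {E. partition_on S E \<and> (\<forall>e\<in>E. card e = 2)}"

text \<open>The double factorial of \<open>n - 1\<close> for even \<open>n\<close>, and 0 for odd
  \<open>n\<close>. The recursion chooses the partner of one fixed element; the same numbers are the
  moments of the standard normal distribution.\<close>

fun matching_number :: "nat \<Rightarrow> nat" where
  "matching_number 0 = 1"
| "matching_number (Suc 0) = 0"
| "matching_number (Suc (Suc n)) = Suc n * matching_number n"

lemma finite_perfect_matchings: "finite S \<Longrightarrow> finite (perfect_matchings S)"
  unfolding perfect_matchings_def
  by (rule finite_subset[of _ "Pow (Pow S)"]) (auto simp: partition_on_def)

text \<open>The partner \<open>y\<close> of a fixed \<open>x\<close> may be any other element, and
  what remains is a matching of the set without both.\<close>

lemma bij_betw_perfect_matchings: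
  assumes "x \<in> S"
  shows "bij_betw (\<lambda>(y, E). insert {x, y} E)
    (SIGMA y:S - {x}. perfect_matchings (S - {x, y})) (perfect_matchings S)"
proof (rule bij_betwI')
  fix p q
  assume p: "p \<in> (SIGMA y:S - {x}. perfect_matchings (S - {x, y}))"
    and q: "q \<in> (SIGMA y:S - {x}. perfect_matchings (S - {x, y}))"
  obtain y E y' E' where pq: "p = (y, E)" "q = (y', E')" by fastforce
  have nx: "\<forall>e\<in>E. x \<notin> e" "\<forall>e\<in>E'. x \<notin> e"
    using p q pq by (auto simp: perfect_matchings_def partition_on_def)
  show "((case p of (y, E) \<Rightarrow> insert {x, y} E) = (case q of (y, E) \<Rightarrow> insert {x, y} E)) = (p = q)"
  proof
    assume "(case p of (y, E) \<Rightarrow> insert {x, y} E) = (case q of (y, E) \<Rightarrow> insert {x, y} E)"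
    then have eq: "insert {x, y} E = insert {x, y'} E'" by (simp add: pq)
    have "{x, y} \<in> insert {x, y'} E'" using eq by blast
    then have 1: "{x, y} = {x, y'}" using nx by auto
    then have yy: "y = y'" by (auto simp: doubleton_eq_iff)
    have "{x, y} \<notin> E" "{x, y} \<notin> E'" using nx by auto
    then have "E = E'" using eq yy by (metis insert_ident)
    then show "p = q" using yy pq by simp
  qed simp
next
  fix p assume p: "p \<in> (SIGMA y:S - {x}. perfect_matchings (S - {x, y}))"
  obtain y E where pq: "p = (y, E)" by fastforce
  have y: "y \<in> S" "y \<noteq> x" and E: "partition_on (S - {x, y}) E" "\<forall>e\<in>E. card e = 2"
    using p pq by (auto simp: perfect_matchings_def)
  have "partition_on S (insert {x, y} E)"
  proof (rule partition_onI)
    show "{} \<notin> insert {x, y} E" using E by (auto simp: partition_on_def)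
    show "\<Union> (insert {x, y} E) = S" using E y assms by (auto simp: partition_on_def)
    fix p p' assume "p \<in> insert {x, y} E" "p' \<in> insert {x, y} E" "p \<noteq> p'"
    then show "disjnt p p'" using E(1)
      by (auto simp: partition_on_def disjoint_def disjnt_def)
  qed
  then show "(case p of (y, E) \<Rightarrow> insert {x, y} E) \<in> perfect_matchings S"
    using E y by (auto simp: perfect_matchings_def pq)
next
  fix M assume M: "M \<in> perfect_matchings S"
  then have pM: "partition_on S M" and c: "\<forall>e\<in>M. card e = 2" by (auto simp: perfect_matchings_def)
  obtain e where e: "e \<in> M" "x \<in> e" using assms pM by (auto simp: partition_on_def)
  obtain y where y: "e = {x, y}" "y \<noteq> x" using c e card_2_iff
    by (metis doubleton_eq_iff empty_iff insert_iff)
  have yS: "y \<in> S" using e y pM by (auto simp: partition_on_def)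
  have "partition_on (S - e) (M - {e})"
  proof (rule partition_onI)
    show "{} \<notin> M - {e}" using pM by (auto simp: partition_on_def)
    show "\<Union> (M - {e}) = S - e" using pM e(1) by (fastforce simp: partition_on_def disjoint_def)
    show "\<And>p p'. p \<in> M - {e} \<Longrightarrow> p' \<in> M - {e} \<Longrightarrow> p \<noteq> p' \<Longrightarrow> disjnt p p'"
      using pM by (auto simp: partition_on_def disjoint_def disjnt_def)
  qed
  then have "(y, M - {e}) \<in> (SIGMA y:S - {x}. perfect_matchings (S - {x, y}))"
    using y yS c by (auto simp: perfect_matchings_def)
  moreover have "M = insert {x, y} (M - {e})" using e y by auto
  ultimately show "\<exists>p\<in>SIGMA y:S - {x}. perfect_matchings (S - {x, y}).
      M = (case p of (y, E) \<Rightarrow> insert {x, y} E)" by blast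
qed

lemma card_perfect_matchings:
  "finite S \<Longrightarrow> card (perfect_matchings S) = matching_number (card S)"
proof (induction "card S" arbitrary: S rule: matching_number.induct)
  case 1
  then have "S = {}" by simp
  then have "perfect_matchings S = {{}}" by (auto simp: perfect_matchings_def partition_on_def)
  then show ?case by (simp add: \<open>S = {}\<close>)
next
  case 2
  then obtain a where S: "S = {a}" by (metis card_1_singletonE One_nat_def)
  have "perfect_matchings S = {}"
  proof (rule equals0I)
    fix E assume E: "E \<in> perfect_matchings S"
    then have "\<Union>E = {a}" by (simp add: perfect_matchings_def partition_on_def S)
    then obtain e where "e \<in> E" "a \<in> e" "e \<subseteq> {a}" by blast
    then have "e = {a}" by auto
    then show False using E \<open>e \<in> E\<close> by (auto simp: perfect_matchings_def)
  qed
  then show ?case using 2 by (simp flip: 2(1))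
next
  case (3 n)
  then obtain x where x: "x \<in> S" by fastforce
  have cn: "card (S - {x, y}) = n" if "y \<in> S - {x}" for y
  proof -
    have "card {x, y} = 2" using that by auto
    then show ?thesis using that x 3(2,3) by (simp add: card_Diff_subset flip: 3(2))
  qed
  have "card (perfect_matchings S) = card (SIGMA y:S - {x}. perfect_matchings (S - {x, y}))"
    using bij_betw_same_card[OF bij_betw_perfect_matchings[OF x]] by simp
  also have "\<dots> = (\<Sum>y\<in>S - {x}. card (perfect_matchings (S - {x, y})))"
    using 3 by (intro card_SigmaI) (auto intro: finite_perfect_matchings)
  also have "\<dots> = (\<Sum>y\<in>S - {x}. matching_number n)"
    using 3 cn by (intro sum.cong) auto
  also have "\<dots> = matching_number (card S)" using x 3 by (simp flip: 3(2))
  finally show ?case .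
qed

section \<open>Set partitions and functions with prescribed fibres\<close>

definition fibre :: "'a set \<Rightarrow> ('a \<Rightarrow> 'b) \<Rightarrow> 'b \<Rightarrow> 'a set" where
  "fibre A \<theta> i = {a \<in> A. \<theta> a = i}"

definition funcs_with_fibre_sizes :: "'a set \<Rightarrow> nat \<Rightarrow> (nat \<Rightarrow> nat) \<Rightarrow> ('a \<Rightarrow> nat) set" where
  "funcs_with_fibre_sizes S m u = {\<phi> \<in> S \<rightarrow>\<^sub>E {..<m}. \<forall>i<m. card (fibre S \<phi> i) = u i}"

lemma finite_funcs_with_fibre_sizes: "finite S \<Longrightarrow> finite (funcs_with_fibre_sizes S m u)"
  unfolding funcs_with_fibre_sizes_def by (rule finite_subset[of _ "S \<rightarrow>\<^sub>E {..<m}"]) (auto intro: finite_PiE)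

text \<open>Splits off the fibre \<open>B\<close> of the largest value: once \<open>B\<close> is
  chosen, a function on \<open>S - B\<close> into the smaller values is left. This is the induction
  step of the multinomial count.\<close>

lemma bij_betw_funcs_with_fibre_sizes:
  assumes "finite S"
  shows "bij_betw (\<lambda>(B, \<phi>). \<lambda>s\<in>S. if s \<in> B then m else \<phi> s)
     (SIGMA B:{B. B \<subseteq> S \<and> card B = u m}. funcs_with_fibre_sizes (S - B) m u)
     (funcs_with_fibre_sizes S (Suc m) u)"
proof (rule bij_betw_byWitness[where f' = "\<lambda>\<theta>. (fibre S \<theta> m, restrict \<theta> (S - fibre S \<theta> m))"])
  show "\<forall>p\<in>SIGMA B:{B. B \<subseteq> S \<and> card B = u m}. funcs_with_fibre_sizes (S - B) m u.
     (\<lambda>\<theta>. (fibre S \<theta> m, restrict \<theta> (S - fibre S \<theta> m)))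
       ((\<lambda>(B, \<phi>). \<lambda>s\<in>S. if s \<in> B then m else \<phi> s) p) = p"
  proof (rule ballI)
    fix p assume "p \<in> (SIGMA B:{B. B \<subseteq> S \<and> card B = u m}. funcs_with_fibre_sizes (S - B) m u)"
    then obtain B \<phi> where p: "p = (B, \<phi>)" and B: "B \<subseteq> S" and "\<phi> \<in> funcs_with_fibre_sizes (S - B) m u"
      by blast
    then have phi: "\<phi> \<in> (S - B) \<rightarrow>\<^sub>E {..<m}" by (simp add: funcs_with_fibre_sizes_def)
    have f: "fibre S (\<lambda>s\<in>S. if s \<in> B then m else \<phi> s) m = B"
      using B phi by (auto simp: fibre_def PiE_iff Ball_def split: if_splits)
    show "(\<lambda>\<theta>. (fibre S \<theta> m, restrict \<theta> (S - fibre S \<theta> m)))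
       ((\<lambda>(B, \<phi>). \<lambda>s\<in>S. if s \<in> B then m else \<phi> s) p) = p"
      unfolding p prod.case f using phi by (auto simp: fun_eq_iff PiE_iff restrict_def extensional_def)
  qed
  show "\<forall>\<theta>\<in>funcs_with_fibre_sizes S (Suc m) u.
     (\<lambda>(B, \<phi>). \<lambda>s\<in>S. if s \<in> B then m else \<phi> s)
       (fibre S \<theta> m, restrict \<theta> (S - fibre S \<theta> m)) = \<theta>"
    by (auto simp: fun_eq_iff funcs_with_fibre_sizes_def fibre_def PiE_iff restrict_def extensional_def)
  show "(\<lambda>(B, \<phi>). \<lambda>s\<in>S. if s \<in> B then m else \<phi> s) `
     (SIGMA B:{B. B \<subseteq> S \<and> card B = u m}. funcs_with_fibre_sizes (S - B) m u)
     \<subseteq> funcs_with_fibre_sizes S (Suc m) u"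
  proof (rule image_subsetI, safe)
    fix B \<phi> assume B: "B \<subseteq> S" "card B = u m" and "\<phi> \<in> funcs_with_fibre_sizes (S - B) m u"
    then have phi: "\<phi> \<in> (S - B) \<rightarrow>\<^sub>E {..<m}" and c: "\<forall>i<m. card (fibre (S - B) \<phi> i) = u i"
      by (simp_all add: funcs_with_fibre_sizes_def)
    have "fibre S (\<lambda>s\<in>S. if s \<in> B then m else \<phi> s) m = B"
      using B phi by (auto simp: fibre_def PiE_iff Ball_def split: if_splits)
    moreover have "fibre S (\<lambda>s\<in>S. if s \<in> B then m else \<phi> s) i = fibre (S - B) \<phi> i" if "i < m" for i
      using B phi that by (auto simp: fibre_def PiE_iff)
    moreover have "(\<lambda>s\<in>S. if s \<in> B then m else \<phi> s) \<in> S \<rightarrow>\<^sub>E {..<Suc m}"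
      using phi by (auto simp: PiE_iff less_Suc_eq)
    ultimately show "(\<lambda>s\<in>S. if s \<in> B then m else \<phi> s) \<in> funcs_with_fibre_sizes S (Suc m) u"
      using c B unfolding funcs_with_fibre_sizes_def by (auto simp: less_Suc_eq)
  qed
  show "(\<lambda>\<theta>. (fibre S \<theta> m, restrict \<theta> (S - fibre S \<theta> m))) ` funcs_with_fibre_sizes S (Suc m) u
     \<subseteq> (SIGMA B:{B. B \<subseteq> S \<and> card B = u m}. funcs_with_fibre_sizes (S - B) m u)"
  proof (rule image_subsetI)
    fix \<theta> assume "\<theta> \<in> funcs_with_fibre_sizes S (Suc m) u"
    then have chi: "\<theta> \<in> S \<rightarrow>\<^sub>E {..<Suc m}" and c: "\<forall>i<Suc m. card (fibre S \<theta> i) = u i"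
      by (simp_all add: funcs_with_fibre_sizes_def)
    let ?B = "fibre S \<theta> m"
    have "fibre (S - ?B) (restrict \<theta> (S - ?B)) i = fibre S \<theta> i" if "i < m" for i
      using that by (auto simp: fibre_def)
    moreover have "restrict \<theta> (S - ?B) \<in> (S - ?B) \<rightarrow>\<^sub>E {..<m}"
      using chi by (auto simp: fibre_def PiE_iff less_Suc_eq)
    ultimately show "(?B, restrict \<theta> (S - ?B)) \<in> (SIGMA B:{B. B \<subseteq> S \<and> card B = u m}. funcs_with_fibre_sizes (S - B) m u)"
      using c by (auto simp: funcs_with_fibre_sizes_def) (auto simp: fibre_def)
  qed
qed

text \<open>The multinomial coefficient, stated as a product so that no division in
  \<open>nat\<close> occurs. The last fibre is any subset of size \<open>u m\<close>, which gives a
  binomial factor, and the induction hypothesis counts the rest.\<close>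

lemma card_funcs_with_fibre_sizes:
  "finite S \<Longrightarrow> (\<Sum>i<m. u i) = card S \<Longrightarrow>
     card (funcs_with_fibre_sizes S m u) * (\<Prod>i<m. fact (u i)) = fact (card S)"
proof (induction m arbitrary: S)
  case 0
  then have "S = {}" by simp
  then show ?case by (simp add: funcs_with_fibre_sizes_def)
next
  case (Suc m)
  let ?Bs = "{B. B \<subseteq> S \<and> card B = u m}"
  have fB: "finite ?Bs" using Suc.prems by simp
  have le: "u m \<le> card S" using Suc.prems by simp
  have cB: "card (S - B) = card S - u m" if "B \<in> ?Bs" for B
    using that Suc.prems by (auto simp: card_Diff_subset finite_subset)
  have IH: "card (funcs_with_fibre_sizes (S - B) m u) * (\<Prod>i<m. fact (u i)) = fact (card S - u m)"
    if "B \<in> ?Bs" for B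
    using Suc.IH[of "S - B"] Suc.prems cB[OF that] by simp
  have "card (funcs_with_fibre_sizes S (Suc m) u) =
        card (SIGMA B:?Bs. funcs_with_fibre_sizes (S - B) m u)"
    using bij_betw_same_card[OF bij_betw_funcs_with_fibre_sizes[OF Suc.prems(1)]] by simp
  also have "\<dots> = (\<Sum>B\<in>?Bs. card (funcs_with_fibre_sizes (S - B) m u))"
    using Suc.prems fB by (intro card_SigmaI) (auto intro: finite_funcs_with_fibre_sizes)
  finally have "card (funcs_with_fibre_sizes S (Suc m) u) * (\<Prod>i<m. fact (u i)) =
       (\<Sum>B\<in>?Bs. fact (card S - u m))"
    using IH by (simp add: sum_distrib_right)
  also have "\<dots> = (card S choose u m) * fact (card S - u m)"
    using Suc.prems by (simp add: n_subsets)
  finally have "card (funcs_with_fibre_sizes S (Suc m) u) * (\<Prod>i<m. fact (u i)) * fact (u m) =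
       fact (u m) * fact (card S - u m) * (card S choose u m)" by (simp add: algebra_simps)
  also have "\<dots> = fact (card S)" using binomial_fact_lemma[OF le] by simp
  finally show ?case by (simp add: mult.assoc)
qed

lemma card_injective_funcset:
  assumes "finite A" "finite B" "card A = card B"
  shows "card {f \<in> A \<rightarrow>\<^sub>E B. inj_on f A} = fact (card A)"
proof -
  have "card {f \<in> A \<rightarrow>\<^sub>E B. inj_on f A} = prod ((-) (card A)) {0..<card A}"
    using card_inj_on_subset_funcset[of A B A] assms by simp
  also have "\<dots> = fact (card A)" by (simp add: fact_prod_rev)
  finally show ?thesis .
qed

lemma inj_on_fibre:
  assumes "\<And>i. i < m \<Longrightarrow> fibre A \<theta> i \<noteq> {}"
  shows "inj_on (fibre A \<theta>) {..<m}"
proof (rule inj_onI)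
  fix i j assume ij: "i \<in> {..<m}" "fibre A \<theta> i = fibre A \<theta> j"
  then obtain a where "a \<in> fibre A \<theta> i" using assms[of i] by blast
  then show "i = j" using ij by (auto simp: fibre_def)
qed

lemma partition_on_fibres:
  assumes "\<theta> \<in> A \<rightarrow> {..<m}" "\<And>i. i < m \<Longrightarrow> fibre A \<theta> i \<noteq> {}"
  shows "partition_on A (fibre A \<theta> ` {..<m})"
proof (rule partition_onI)
  show "\<Union> (fibre A \<theta> ` {..<m}) = A" using assms(1) by (auto simp: fibre_def)
  show "{} \<notin> fibre A \<theta> ` {..<m}" using assms(2) by auto
qed (auto simp: fibre_def disjnt_def)

text \<open>Sending \<open>i\<close> to its fibre identifies such functions with the injections of
  \<open>{..<m}\<close> into \<open>V\<close>, that is, with the orderings of the \<open>m\<close>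
  blocks.\<close>

lemma card_functions_with_fibres:
  assumes A: "finite A" and V: "partition_on A V" "card V = m"
  shows "card {\<theta> \<in> A \<rightarrow>\<^sub>E {..<m}. (\<forall>i<m. fibre A \<theta> i \<noteq> {}) \<and> fibre A \<theta> ` {..<m} = V} = fact m"
proof -
  let ?X = "{\<theta> \<in> A \<rightarrow>\<^sub>E {..<m}. (\<forall>i<m. fibre A \<theta> i \<noteq> {}) \<and> fibre A \<theta> ` {..<m} = V}"
  let ?Y = "{e \<in> {..<m} \<rightarrow>\<^sub>E V. inj_on e {..<m}}"
  let ?f = "\<lambda>\<theta>. \<lambda>i\<in>{..<m}. fibre A \<theta> i"
  have fV: "finite V" using finite_elements[OF A V(1)] .
  have "bij_betw ?f ?X ?Y"
    unfolding bij_betw_def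
  proof
    show "inj_on ?f ?X"
    proof (rule inj_onI, rule ext)
      fix \<theta> \<eta> a assume t: "\<theta> \<in> ?X" "\<eta> \<in> ?X" and eq: "?f \<theta> = ?f \<eta>"
      show "\<theta> a = \<eta> a"
      proof (cases "a \<in> A")
        case True
        then have "\<theta> a < m" using t by auto
        then have "fibre A \<theta> (\<theta> a) = fibre A \<eta> (\<theta> a)" using fun_cong[OF eq, of "\<theta> a"] by simp
        then have "a \<in> fibre A \<eta> (\<theta> a)" using True by (auto simp: fibre_def)
        then show ?thesis by (simp add: fibre_def)
      next
        case False
        then show ?thesis using t by (simp add: PiE_iff extensional_def)
      qed
    qed
    show "?f ` ?X = ?Y"
    proof (rule set_eqI, rule iffI)
      fix e assume "e \<in> ?f ` ?X"
      then obtain \<theta> where t: "\<theta> \<in> ?X" "e = ?f \<theta>" by blast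
      have "inj_on (fibre A \<theta>) {..<m}" using t by (intro inj_on_fibre) auto
      then have "inj_on e {..<m}" unfolding t by (simp add: inj_on_def)
      then show "e \<in> ?Y" using t by auto
    next
      fix e assume e: "e \<in> ?Y"
      have im: "e ` {..<m} = V"
        using e V fV by (intro card_subset_eq) (auto simp: card_image)
      \<comment> \<open>The inverse: \<open>a\<close> is mapped to the index of its block. The index
        is unique because the blocks are disjoint and \<open>e\<close> is injective.\<close>
      let ?t = "\<lambda>a\<in>A. THE i. i < m \<and> a \<in> e i"
      have ex: "\<exists>!i. i < m \<and> a \<in> e i" if a: "a \<in> A" for a
      proof -
        obtain v where "v \<in> V" "a \<in> v" using a V by (auto simp: partition_on_def)
        then obtain i where i: "i < m" "a \<in> e i" using im by auto
        moreover have "j = i" if "j < m" "a \<in> e j" for j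
        proof -
          have "e i = e j" using i that e V
            by (auto simp: partition_on_def disjoint_def)
          then show ?thesis using e i that by (auto simp: inj_on_def)
        qed
        ultimately show ?thesis by blast
      qed
      have t: "?t a < m \<and> a \<in> e (?t a)" if "a \<in> A" for a
        using theI'[OF ex[OF that]] that by simp
      have fib: "fibre A ?t i = e i" if i: "i < m" for i
      proof (rule set_eqI, rule iffI)
        fix a assume "a \<in> fibre A ?t i"
        then show "a \<in> e i" using t[of a] by (auto simp: fibre_def)
      next
        fix a assume a: "a \<in> e i"
        have "e i \<in> V" using e i by auto
        then have aA: "a \<in> A" using a V by (auto simp: partition_on_def)
        then have "?t a = i" using ex[OF aA] t[OF aA] a i by blast
        then show "a \<in> fibre A ?t i" using aA by (simp add: fibre_def)
      qed
      have ne: "e i \<noteq> {}" if "i < m" for i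
      proof -
        have "e i \<in> V" using e that by auto
        then show ?thesis using V by (auto simp: partition_on_def)
      qed
      have "?t \<in> ?X" using t fib ne im by (auto simp: image_iff)
      moreover have "e = ?f ?t" using e fib
        by (auto simp: fun_eq_iff PiE_iff extensional_def restrict_def)
      ultimately show "e \<in> ?f ` ?X" by blast
    qed
  qed
  then have "card ?X = card ?Y" by (rule bij_betw_same_card)
  also have "\<dots> = fact m" using card_injective_funcset[of "{..<m}" V] fV V by simp
  finally show ?thesis .
qed

text \<open>Functions that miss a value have an empty fibre and vanish by \<open>F {} = 0\<close>.
  The others are grouped by their set of fibres, and each partition arises from
  \<open>fact m\<close> of them.\<close>

lemma sum_functions_eq_sum_partitions:
  fixes F :: "'a set \<Rightarrow> real"
  assumes A: "finite A" and F: "F {} = 0"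
  shows "(\<Sum>\<theta>\<in>A \<rightarrow>\<^sub>E {..<m}. \<Prod>i<m. F (fibre A \<theta> i)) =
         fact m * (\<Sum>V\<in>{V. partition_on A V \<and> card V = m}. \<Prod>v\<in>V. F v)"
proof -
  let ?X = "{\<theta> \<in> A \<rightarrow>\<^sub>E {..<m}. \<forall>i<m. fibre A \<theta> i \<noteq> {}}"
  let ?Ps = "{V. partition_on A V \<and> card V = m}"
  have fin: "finite (A \<rightarrow>\<^sub>E {..<m})" using A by (auto intro: finite_PiE)
  have fP: "finite ?Ps" using finitely_many_partition_on[OF A] by (rule rev_finite_subset) auto
  have "(\<Sum>\<theta>\<in>A \<rightarrow>\<^sub>E {..<m}. \<Prod>i<m. F (fibre A \<theta> i)) = (\<Sum>\<theta>\<in>?X. \<Prod>i<m. F (fibre A \<theta> i))"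
  proof (rule sum.mono_neutral_right[OF fin])
    show "\<forall>\<theta>\<in>(A \<rightarrow>\<^sub>E {..<m}) - ?X. (\<Prod>i<m. F (fibre A \<theta> i)) = 0"
    proof
      fix \<theta> assume "\<theta> \<in> (A \<rightarrow>\<^sub>E {..<m}) - ?X"
      then obtain i where "i < m" "fibre A \<theta> i = {}" by auto
      then show "(\<Prod>i<m. F (fibre A \<theta> i)) = 0"
        using F by (intro prod_zero) (auto intro!: bexI[of _ i])
    qed
  qed auto
  also have "\<dots> = (\<Sum>V\<in>?Ps. \<Sum>\<theta>\<in>{\<theta>\<in>?X. fibre A \<theta> ` {..<m} = V}. \<Prod>i<m. F (fibre A \<theta> i))"
  proof (rule sum.group[symmetric])
    show "finite ?X" using fin by (rule rev_finite_subset) auto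
    show "(\<lambda>\<theta>. fibre A \<theta> ` {..<m}) ` ?X \<subseteq> ?Ps"
    proof (rule image_subsetI)
      fix \<theta> assume "\<theta> \<in> ?X"
      then show "fibre A \<theta> ` {..<m} \<in> ?Ps"
        using partition_on_fibres[of \<theta> A m] card_image[OF inj_on_fibre[of m A \<theta>]] by auto
    qed
  qed (rule fP)
  also have "\<dots> = (\<Sum>V\<in>?Ps. \<Sum>\<theta>\<in>{\<theta>\<in>?X. fibre A \<theta> ` {..<m} = V}. \<Prod>v\<in>V. F v)"
  proof (rule sum.cong[OF refl], rule sum.cong[OF refl])
    fix V \<theta> assume t: "\<theta> \<in> {\<theta>\<in>?X. fibre A \<theta> ` {..<m} = V}"
    then have "inj_on (fibre A \<theta>) {..<m}" by (intro inj_on_fibre) auto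
    then have "(\<Prod>v\<in>fibre A \<theta> ` {..<m}. F v) = (\<Prod>i<m. F (fibre A \<theta> i))"
      by (simp add: prod.reindex)
    then show "(\<Prod>i<m. F (fibre A \<theta> i)) = (\<Prod>v\<in>V. F v)" using t by simp
  qed
  also have "\<dots> = (\<Sum>V\<in>?Ps. fact m * (\<Prod>v\<in>V. F v))"
    using card_functions_with_fibres[OF A] by (intro sum.cong) (auto simp: conj_assoc)
  finally show ?thesis by (simp add: sum_distrib_left)
qed

section \<open>Sequences of bidegrees with prescribed totals\<close>

definition degree_families :: "nat \<Rightarrow> nat \<Rightarrow> nat \<Rightarrow> (nat \<Rightarrow> nat \<times> nat) set" where
  "degree_families m U W =
     {f \<in> {..<m} \<rightarrow>\<^sub>E UNIV. (\<Sum>i<m. fst (f i)) = U \<and> (\<Sum>i<m. snd (f i)) = W}"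

lemma finite_degree_families: "finite (degree_families m U W)"
proof (rule finite_subset)
  show "degree_families m U W \<subseteq> {..<m} \<rightarrow>\<^sub>E {..U} \<times> {..W}"
  proof
    fix f assume f: "f \<in> degree_families m U W"
    have "fst (f i) \<le> U" "snd (f i) \<le> W" if "i < m" for i
      using f that member_le_sum[of i "{..<m}" "\<lambda>i. fst (f i)"] member_le_sum[of i "{..<m}" "\<lambda>i. snd (f i)"]
      by (auto simp: degree_families_def)
    then show "f \<in> {..<m} \<rightarrow>\<^sub>E {..U} \<times> {..W}" using f
      by (auto simp: degree_families_def PiE_iff mem_Times_iff)
  qed
qed (auto intro: finite_PiE)

lemma sum_card_fibres:
  fixes m :: nat
  assumes "finite S" "\<theta> \<in> S \<rightarrow> {..<m}"
  shows "(\<Sum>i<m. card (fibre S \<theta> i)) = card S"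
proof -
  have "card S = (\<Sum>s\<in>S. 1)" by simp
  also have "\<dots> = (\<Sum>i<m. \<Sum>s\<in>{s\<in>S. \<theta> s = i}. 1)"
    using assms by (intro sum.group[symmetric]) auto
  finally show ?thesis by (simp add: fibre_def)
qed

lemma fibre_Un_Int:
  "fibre (S \<union> T) \<theta> i \<inter> S = fibre S (restrict \<theta> S) i"
  "fibre (S \<union> T) \<theta> i \<inter> T = fibre T (restrict \<theta> T) i"
  by (auto simp: fibre_def)

text \<open>As \<open>S\<close> and \<open>T\<close> are disjoint, a function on the union is a pair
  of independent restrictions. Fixing the bidegrees fixes the fibre sizes of both, so the count is a
  product of two multinomial coefficients.\<close>

lemma card_functions_with_bidegrees:
  assumes fin: "finite S" "finite T" and disj: "S \<inter> T = {}" and f: "f \<in> degree_families m (card S) (card T)"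
  shows "real (card {\<theta> \<in> S \<union> T \<rightarrow>\<^sub>E {..<m}. (\<lambda>i\<in>{..<m}.
      (card (fibre (S \<union> T) \<theta> i \<inter> S), card (fibre (S \<union> T) \<theta> i \<inter> T))) = f}) =
     fact (card S) * fact (card T) / (\<Prod>i<m. fact (fst (f i)) * fact (snd (f i)))"
proof -
  let ?X = "{\<theta> \<in> S \<union> T \<rightarrow>\<^sub>E {..<m}. (\<lambda>i\<in>{..<m}.
      (card (fibre (S \<union> T) \<theta> i \<inter> S), card (fibre (S \<union> T) \<theta> i \<inter> T))) = f}"
  let ?Y = "funcs_with_fibre_sizes S m (fst \<circ> f)" and ?Z = "funcs_with_fibre_sizes T m (snd \<circ> f)"
  have "bij_betw (\<lambda>\<theta>. (restrict \<theta> S, restrict \<theta> T)) ?X (?Y \<times> ?Z)"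
  proof (rule bij_betw_byWitness[where f' = "\<lambda>(\<phi>, \<psi>). \<lambda>a\<in>S \<union> T. if a \<in> S then \<phi> a else \<psi> a"])
    show "\<forall>\<theta>\<in>?X. (\<lambda>(\<phi>, \<psi>). \<lambda>a\<in>S \<union> T. if a \<in> S then \<phi> a else \<psi> a) (restrict \<theta> S, restrict \<theta> T) = \<theta>"
      by (auto simp: fun_eq_iff PiE_iff extensional_def restrict_def)
    show "\<forall>p\<in>?Y \<times> ?Z. (\<lambda>\<theta>. (restrict \<theta> S, restrict \<theta> T))
       ((\<lambda>(\<phi>, \<psi>). \<lambda>a\<in>S \<union> T. if a \<in> S then \<phi> a else \<psi> a) p) = p"
    proof
      fix p assume p: "p \<in> ?Y \<times> ?Z"
      then obtain \<phi> \<psi> where pq: "p = (\<phi>, \<psi>)" "\<phi> \<in> extensional S" "\<psi> \<in> extensional T"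
        by (cases p) (auto simp: funcs_with_fibre_sizes_def PiE_def)
      then show "(\<lambda>\<theta>. (restrict \<theta> S, restrict \<theta> T))
         ((\<lambda>(\<phi>, \<psi>). \<lambda>a\<in>S \<union> T. if a \<in> S then \<phi> a else \<psi> a) p) = p"
        using disj by (auto simp: fun_eq_iff extensional_def restrict_def)
    qed
    show "(\<lambda>\<theta>. (restrict \<theta> S, restrict \<theta> T)) ` ?X \<subseteq> ?Y \<times> ?Z"
    proof (rule image_subsetI)
      fix \<theta> assume t: "\<theta> \<in> ?X"
      have "(card (fibre S (restrict \<theta> S) i), card (fibre T (restrict \<theta> T) i)) = f i" if "i < m" for i
        using t that unfolding fibre_Un_Int by auto
      then have "card (fibre S (restrict \<theta> S) i) = fst (f i) \<and> card (fibre T (restrict \<theta> T) i) = snd (f i)"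
        if "i < m" for i using that by (metis fst_conv snd_conv)
      then show "(restrict \<theta> S, restrict \<theta> T) \<in> ?Y \<times> ?Z"
        using t by (auto simp: funcs_with_fibre_sizes_def PiE_iff)
    qed
    show "(\<lambda>(\<phi>, \<psi>). \<lambda>a\<in>S \<union> T. if a \<in> S then \<phi> a else \<psi> a) ` (?Y \<times> ?Z) \<subseteq> ?X"
    proof (rule image_subsetI)
      fix p assume p: "p \<in> ?Y \<times> ?Z"
      then obtain \<phi> \<psi> where pq: "p = (\<phi>, \<psi>)" and phi: "\<phi> \<in> ?Y" and psi: "\<psi> \<in> ?Z" by auto
      let ?t = "\<lambda>a\<in>S \<union> T. if a \<in> S then \<phi> a else \<psi> a"
      have r: "restrict ?t S = \<phi>" "restrict ?t T = \<psi>"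
        using phi psi disj
        by (auto simp: fun_eq_iff funcs_with_fibre_sizes_def PiE_iff extensional_def restrict_def)
      have "(\<lambda>i\<in>{..<m}. (card (fibre S \<phi> i), card (fibre T \<psi> i))) = f"
        using phi psi f by (auto simp: fun_eq_iff funcs_with_fibre_sizes_def degree_families_def extensional_def)
      moreover have "?t \<in> S \<union> T \<rightarrow>\<^sub>E {..<m}"
        using phi psi by (auto simp: funcs_with_fibre_sizes_def PiE_iff)
      ultimately show "(\<lambda>(\<phi>, \<psi>). \<lambda>a\<in>S \<union> T. if a \<in> S then \<phi> a else \<psi> a) p \<in> ?X"
        unfolding pq prod.case mem_Collect_eq fibre_Un_Int r by blast
    qed
  qed
  then have c: "card ?X = card ?Y * card ?Z" using bij_betw_same_card by (fastforce simp: card_cartesian_product)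
  have "card ?Y * (\<Prod>i<m. fact (fst (f i))) = fact (card S)"
    using card_funcs_with_fibre_sizes[where S = S and m = m and u = "fst \<circ> f"] fin f by (simp add: degree_families_def)
  moreover have "card ?Z * (\<Prod>i<m. fact (snd (f i))) = fact (card T)"
    using card_funcs_with_fibre_sizes[where S = T and m = m and u = "snd \<circ> f"] fin f by (simp add: degree_families_def)
  ultimately have "card ?X * (\<Prod>i<m. fact (fst (f i)) * fact (snd (f i))) = fact (card S) * fact (card T)"
    unfolding c prod.distrib by (metis (no_types, lifting) mult.assoc mult.left_commute)
  then have "real (card ?X) * (\<Prod>i<m. fact (fst (f i)) * fact (snd (f i))) = fact (card S) * fact (card T)"
    by (metis (mono_tags, lifting) of_nat_fact of_nat_mult of_nat_prod prod.cong)
  then show ?thesis by (simp add: field_simps)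
qed

lemma sum_functions_bidegree:
  fixes G :: "nat \<times> nat \<Rightarrow> real"
  assumes fin: "finite S" "finite T" and disj: "S \<inter> T = {}"
  shows "(\<Sum>\<theta>\<in>S \<union> T \<rightarrow>\<^sub>E {..<m}. \<Prod>i<m. G (card (fibre (S \<union> T) \<theta> i \<inter> S), card (fibre (S \<union> T) \<theta> i \<inter> T))) =
    fact (card S) * fact (card T) *
      (\<Sum>f\<in>degree_families m (card S) (card T). \<Prod>i<m. G (f i) / (fact (fst (f i)) * fact (snd (f i))))"
proof -
  let ?g = "\<lambda>\<theta>. \<lambda>i\<in>{..<m}. (card (fibre (S \<union> T) \<theta> i \<inter> S), card (fibre (S \<union> T) \<theta> i \<inter> T))"
  let ?D = "degree_families m (card S) (card T)"
  have "(\<Sum>\<theta>\<in>S \<union> T \<rightarrow>\<^sub>E {..<m}. \<Prod>i<m. G (card (fibre (S \<union> T) \<theta> i \<inter> S), card (fibre (S \<union> T) \<theta> i \<inter> T)))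
      = (\<Sum>\<theta>\<in>S \<union> T \<rightarrow>\<^sub>E {..<m}. \<Prod>i<m. G (?g \<theta> i))"
    by simp
  also have "\<dots> = (\<Sum>f\<in>?D. \<Sum>\<theta>\<in>{\<theta>\<in>S \<union> T \<rightarrow>\<^sub>E {..<m}. ?g \<theta> = f}. \<Prod>i<m. G (?g \<theta> i))"
  proof (rule sum.group[symmetric])
    show "finite (S \<union> T \<rightarrow>\<^sub>E {..<m})" using fin by (auto intro: finite_PiE)
    show "?g ` (S \<union> T \<rightarrow>\<^sub>E {..<m}) \<subseteq> ?D"
    proof (rule image_subsetI)
      fix \<theta> assume t: "\<theta> \<in> S \<union> T \<rightarrow>\<^sub>E {..<m}"
      have "(\<Sum>i<m. card (fibre (S \<union> T) \<theta> i \<inter> S)) = card S"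
        unfolding fibre_Un_Int using t fin by (intro sum_card_fibres) auto
      moreover have "(\<Sum>i<m. card (fibre (S \<union> T) \<theta> i \<inter> T)) = card T"
        unfolding fibre_Un_Int using t fin by (intro sum_card_fibres) auto
      ultimately show "?g \<theta> \<in> ?D" by (simp add: degree_families_def)
    qed
  qed (rule finite_degree_families)
  also have "\<dots> = (\<Sum>f\<in>?D. \<Sum>\<theta>\<in>{\<theta>\<in>S \<union> T \<rightarrow>\<^sub>E {..<m}. ?g \<theta> = f}. \<Prod>i<m. G (f i))"
    by (intro sum.cong refl) auto
  also have "\<dots> = (\<Sum>f\<in>?D. real (card {\<theta>\<in>S \<union> T \<rightarrow>\<^sub>E {..<m}. ?g \<theta> = f}) * (\<Prod>i<m. G (f i)))"
    by simp
  also have "\<dots> = (\<Sum>f\<in>?D. fact (card S) * fact (card T) * (\<Prod>i<m. G (f i) / (fact (fst (f i)) * fact (snd (f i)))))"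
    by (intro sum.cong refl) (simp add: card_functions_with_bidegrees[OF fin disj] prod_dividef)
  finally show ?thesis by (simp add: sum_distrib_left)
qed

text \<open>An exponential formula in two colours, by counting functions into \<open>{..<m}\<close>
  twice: by the partition into fibres and by the sequence of bidegrees. \<open>G (0, 0) = 0\<close>
  is the condition that empty fibres do not count.\<close>

lemma sum_partitions_bidegree:
  fixes G :: "nat \<times> nat \<Rightarrow> real"
  assumes fin: "finite S" "finite T" and disj: "S \<inter> T = {}" and G: "G (0, 0) = 0"
  shows "(\<Sum>V\<in>{V. partition_on (S \<union> T) V \<and> card V = m}. \<Prod>v\<in>V. G (card (v \<inter> S), card (v \<inter> T)))
    / (fact (card S) * fact (card T)) =
      (\<Sum>f\<in>degree_families m (card S) (card T). \<Prod>i<m. G (f i) / (fact (fst (f i)) * fact (snd (f i)))) / fact m"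
  using sum_functions_bidegree[OF fin disj, where m = m and G = G]
    sum_functions_eq_sum_partitions[of "S \<union> T" "\<lambda>v. G (card (v \<inter> S), card (v \<inter> T))" m] assms
  by (simp add: field_simps)

section \<open>Labelled graphs\<close>

lemma edge_bicolored_graph_onD:
  assumes "edge_bicolored_graph_on S T G"
  shows "finite S" "finite T" "S \<inter> T = {}" "partition_on (S \<union> T) (verts G)"
    "red_edges G \<in> perfect_matchings S" "yellow_edges G \<in> perfect_matchings T"
    "red_halves G = S" "yellow_halves G = T"
  using assms edge_bicolored_graph_on_halves[OF assms]
  by (auto simp: edge_bicolored_graph_on_def perfect_matchings_def)

lemma edge_bicolored_graph_on_iff:
  "edge_bicolored_graph_on S T G \<longleftrightarrow> finite S \<and> finite T \<and> S \<inter> T = {} \<and>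
     partition_on (S \<union> T) (verts G) \<and> red_edges G \<in> perfect_matchings S \<and>
     yellow_edges G \<in> perfect_matchings T"
  by (auto simp: edge_bicolored_graph_on_def perfect_matchings_def)

lemma verts_subset: "edge_bicolored_graph_on S T G \<Longrightarrow> v \<in> verts G \<Longrightarrow> v \<subseteq> S \<union> T"
  by (auto simp: edge_bicolored_graph_on_def partition_on_def)

lemma empty_notin_image_image: "{} \<notin> V \<Longrightarrow> {} \<notin> (`) f ` V"
  by auto

lemma perfect_matchings_image:
  assumes "E \<in> perfect_matchings S" "bij_betw j S S'"
  shows "(`) j ` E \<in> perfect_matchings S'"
proof -
  have E: "partition_on S E" "\<forall>e\<in>E. card e = 2" and j: "inj_on j S" "j ` S = S'"
    using assms by (auto simp: perfect_matchings_def bij_betw_def)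
  have "{} \<notin> (`) j ` E" by (rule empty_notin_image_image[OF partition_onD3[OF E(1)]])
  then have "partition_on S' ((`) j ` E)"
    using partition_on_inj_image[OF E(1) j(1)] j(2) by simp
  moreover have "card (j ` e) = 2" if "e \<in> E" for e
    using that E j by (subst card_image) (auto simp: partition_on_def intro: inj_on_subset)
  ultimately show ?thesis by (auto simp: perfect_matchings_def)
qed

section \<open>Relabelling of half-edges, and isomorphisms as relabellings\<close>

definition relabel_vertex :: "'a set \<Rightarrow> 'a set \<Rightarrow> ('a \<Rightarrow> 'b) \<Rightarrow> ('a \<Rightarrow> 'b) \<Rightarrow> 'a set \<Rightarrow> 'b set" where
  "relabel_vertex S T j k v = j ` (v \<inter> S) \<union> k ` (v \<inter> T)"

text \<open>Transport of structure. The three image conditions in \<open>graph_isos\<close> become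
  the single equation \<open>relabel j k G = H\<close>, so composition and inversion of isomorphisms
  reduce to \<open>relabel_relabel\<close> and \<open>relabel_id\<close>.\<close>

definition relabel :: "('a \<Rightarrow> 'b) \<Rightarrow> ('a \<Rightarrow> 'b) \<Rightarrow> 'a bigraph \<Rightarrow> 'b bigraph" where
  "relabel j k G =
     \<lparr>verts = relabel_vertex (red_halves G) (yellow_halves G) j k ` verts G,
      red_edges = (`) j ` red_edges G, yellow_edges = (`) k ` yellow_edges G\<rparr>"

lemma relabel_vertex_eq_image:
  assumes "S \<inter> T = {}" "v \<subseteq> S \<union> T"
  shows "relabel_vertex S T j k v = (\<lambda>a. if a \<in> S then j a else k a) ` v"
  using assms by (force simp: relabel_vertex_def image_iff)

text \<open>Disjointness of \<open>S'\<close> and \<open>T'\<close> lets \<open>j\<close> and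
  \<open>k\<close> be glued to one injection \<open>?h\<close> on all half-edges, whose image of a
  partition is a partition.\<close>

lemma edge_bicolored_graph_on_relabel:
  assumes G: "edge_bicolored_graph_on S T G" and j: "bij_betw j S S'" and k: "bij_betw k T T'"
    and disj: "S' \<inter> T' = {}"
  shows "edge_bicolored_graph_on S' T' (relabel j k G)"
proof -
  note D = edge_bicolored_graph_onD[OF G]
  let ?h = "\<lambda>a. if a \<in> S then j a else k a"
  have h: "bij_betw ?h (S \<union> T) (S' \<union> T')"
  proof (rule bij_betw_combine[OF _ _ disj])
    show "bij_betw ?h S S'" using j by (subst bij_betw_cong[of S ?h j]) auto
    show "bij_betw ?h T T'" using k D(3) by (subst bij_betw_cong[of T ?h k]) auto
  qed
  have eq: "relabel_vertex S T j k ` verts G = (`) ?h ` verts G"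
    by (intro image_cong[OF refl] relabel_vertex_eq_image D(3) verts_subset[OF G])
  \<comment> \<open>\<open>partition_on_inj_image\<close> speaks of the image minus
    \<open>{{}}\<close>; this fact makes the subtraction void.\<close>
  have ne: "{} \<notin> (`) ?h ` verts G"
    by (rule empty_notin_image_image[OF partition_onD3[OF D(4)]])
  then have "partition_on (S' \<union> T') (relabel_vertex S T j k ` verts G)"
    using partition_on_inj_image[OF D(4) bij_betw_imp_inj_on[OF h]]
    unfolding eq bij_betw_imp_surj_on[OF h] by (simp only: Diff_insert0[OF ne] Diff_empty)
  then show ?thesis
    using D perfect_matchings_image[OF D(5) j] perfect_matchings_image[OF D(6) k] disj
      bij_betw_finite[OF j] bij_betw_finite[OF k]
    by (simp add: edge_bicolored_graph_on_iff relabel_def)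
qed

lemma mem_graph_isos_iff:
  assumes "edge_bicolored_graph_on S T G" "edge_bicolored_graph_on S' T' H"
  shows "(j, k) \<in> graph_isos G H \<longleftrightarrow>
    j \<in> extensional S \<and> bij_betw j S S' \<and> k \<in> extensional T \<and> bij_betw k T T' \<and> relabel j k G = H"
  using edge_bicolored_graph_onD(7,8)[OF assms(1)] edge_bicolored_graph_onD(7,8)[OF assms(2)]
  by (auto simp: graph_isos_def relabel_def relabel_vertex_def[abs_def] intro: bigraph.equality)

lemma relabel_relabel:
  assumes G: "edge_bicolored_graph_on S T G" and j: "bij_betw j S S'" and k: "bij_betw k T T'"
    and disj: "S' \<inter> T' = {}"
  shows "relabel j' k' (relabel j k G) = relabel (compose S j' j) (compose T k' k) G"
proof -
  note D = edge_bicolored_graph_onD[OF G]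
  note D' = edge_bicolored_graph_onD[OF edge_bicolored_graph_on_relabel[OF assms]]
  have sub: "e \<subseteq> S" if "e \<in> red_edges G" for e using that D(5) by (auto simp: perfect_matchings_def partition_on_def)
  have sub2: "e \<subseteq> T" if "e \<in> yellow_edges G" for e using that D(6) by (auto simp: perfect_matchings_def partition_on_def)
  have "relabel_vertex S' T' j' k' (relabel_vertex S T j k v)
      = relabel_vertex S T (compose S j' j) (compose T k' k) v" for v
  proof -
    have "relabel_vertex S T j k v \<inter> S' = j ` (v \<inter> S)" "relabel_vertex S T j k v \<inter> T' = k ` (v \<inter> T)"
      using j k disj by (auto simp: relabel_vertex_def bij_betw_def)
    then show ?thesis
      unfolding relabel_vertex_def[of S' T'] relabel_vertex_def[of S T "compose S j' j"]
      by (auto simp: compose_def)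
  qed
  moreover have "(`) j' ` (`) j ` red_edges G = (`) (compose S j' j) ` red_edges G"
    unfolding image_image using sub by (intro image_cong refl) (auto simp: compose_def image_iff)
  moreover have "(`) k' ` (`) k ` yellow_edges G = (`) (compose T k' k) ` yellow_edges G"
    unfolding image_image using sub2 by (intro image_cong refl) (auto simp: compose_def image_iff)
  ultimately show ?thesis
    unfolding relabel_def[of j' k'] relabel_def[of "compose S j' j"] D(7,8) D'(7,8)
    by (simp add: relabel_def image_image D)
qed

lemma relabel_id:
  assumes G: "edge_bicolored_graph_on S T G"
    and "\<And>a. a \<in> S \<Longrightarrow> j a = a" "\<And>a. a \<in> T \<Longrightarrow> k a = a"
  shows "relabel j k G = G"
proof -
  note D = edge_bicolored_graph_onD[OF G]
  have *: "f ` e = e" if "\<And>a. a \<in> A \<Longrightarrow> f a = a" "e \<subseteq> A" for f :: "'a \<Rightarrow> 'a" and e A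
    using that by force
  have "j ` e = e" if "e \<in> red_edges G" for e
    using D(5) that assms(2) by (intro *[of S]) (auto simp: perfect_matchings_def partition_on_def)
  then have "(`) j ` red_edges G = red_edges G" by simp
  moreover have "k ` e = e" if "e \<in> yellow_edges G" for e
    using D(6) that assms(3) by (intro *[of T]) (auto simp: perfect_matchings_def partition_on_def)
  then have "(`) k ` yellow_edges G = yellow_edges G" by simp
  moreover have "relabel_vertex S T j k ` verts G = verts G"
  proof -
    have "relabel_vertex S T j k v = v" if "v \<in> verts G" for v
      using verts_subset[OF G that] *[of S j "v \<inter> S"] *[of T k "v \<inter> T"] assms(2,3)
      by (auto simp: relabel_vertex_def)
    then show ?thesis by simp
  qed
  ultimately show ?thesis by (simp add: relabel_def D)
qed

text \<open>Isomorphisms must be extensional, while bijections between label sets are obtained as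
  arbitrary functions. Restricting is the same as composing with the restricted identity, which
  fixes \<open>G\<close>.\<close>

lemma relabel_restrict:
  assumes G: "edge_bicolored_graph_on S T G"
  shows "relabel (restrict j S) (restrict k T) G = relabel j k G"
proof -
  have b: "bij_betw (restrict id A) A A" for A :: "'a set" by (simp add: bij_betw_def inj_on_def)
  have c: "compose A f (restrict id A) = restrict f A" for f :: "'a \<Rightarrow> 'b" and A
    by (simp add: fun_eq_iff compose_def)
  have "relabel (restrict id S) (restrict id T) G = G" by (rule relabel_id[OF G]) simp_all
  then show ?thesis
    using relabel_relabel[OF G b b edge_bicolored_graph_onD(3)[OF G], of j k] unfolding c by simp
qed

lemma graph_isos_refl:
  assumes G: "edge_bicolored_graph_on S T G"
  shows "(restrict id S, restrict id T) \<in> graph_isos G G"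
  using relabel_id[OF G, of "restrict id S" "restrict id T"]
  by (simp add: mem_graph_isos_iff[OF G G] bij_betw_def inj_on_def)

lemma graph_isos_compose:
  assumes G: "edge_bicolored_graph_on S T G" and H: "edge_bicolored_graph_on S' T' H"
    and K: "edge_bicolored_graph_on S'' T'' K"
    and "(j, k) \<in> graph_isos G H" "(j', k') \<in> graph_isos H K"
  shows "(compose S j' j, compose T k' k) \<in> graph_isos G K"
proof -
  have 1: "bij_betw j S S'" "bij_betw k T T'" "relabel j k G = H"
    using assms(4) by (auto simp: mem_graph_isos_iff[OF G H])
  have 2: "bij_betw j' S' S''" "bij_betw k' T' T''" "relabel j' k' H = K"
    using assms(5) by (auto simp: mem_graph_isos_iff[OF H K])
  have "relabel (compose S j' j) (compose T k' k) G = K"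
    using relabel_relabel[OF G 1(1,2) edge_bicolored_graph_onD(3)[OF H], of j' k'] 1 2 by simp
  then show ?thesis
    using bij_betw_compose[OF 1(1) 2(1)] bij_betw_compose[OF 1(2) 2(2)]
    by (simp add: mem_graph_isos_iff[OF G K])
qed

lemma graph_isos_inverse:
  assumes G: "edge_bicolored_graph_on S T G" and H: "edge_bicolored_graph_on S' T' H"
    and iso: "(j, k) \<in> graph_isos G H"
  shows "(restrict (inv_into S j) S', restrict (inv_into T k) T') \<in> graph_isos H G"
proof -
  have j: "bij_betw j S S'" and k: "bij_betw k T T'" and eq: "relabel j k G = H"
    using iso by (auto simp: mem_graph_isos_iff[OF G H])
  have "relabel (restrict (inv_into S j) S') (restrict (inv_into T k) T') H = G"
    unfolding eq[symmetric] relabel_relabel[OF G j k edge_bicolored_graph_onD(3)[OF H]]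
    using j k by (intro relabel_id[OF G]) (auto simp: compose_def bij_betw_def)
  moreover have "bij_betw (restrict (inv_into S j) S') S' S" "bij_betw (restrict (inv_into T k) T') T' T"
    using bij_betw_inv_into[OF j] bij_betw_inv_into[OF k] by simp_all
  ultimately show ?thesis by (simp add: mem_graph_isos_iff[OF H G])
qed

section \<open>Counting isomorphisms, automorphisms and orbits\<close>

lemma finite_graph_isos:
  assumes G: "edge_bicolored_graph_on S T G" and H: "edge_bicolored_graph_on S' T' H"
  shows "finite (graph_isos G H)"
proof (rule finite_subset)
  show "graph_isos G H \<subseteq> (S \<rightarrow>\<^sub>E S') \<times> (T \<rightarrow>\<^sub>E T')"
    using mem_graph_isos_iff[OF G H] by (auto simp: PiE_def bij_betw_def extensional_def)
  show "finite ((S \<rightarrow>\<^sub>E S') \<times> (T \<rightarrow>\<^sub>E T'))"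
    using edge_bicolored_graph_onD(1,2)[OF G] edge_bicolored_graph_onD(1,2)[OF H]
    by (auto intro: finite_PiE)
qed

lemma compose_inj:
  assumes "bij_betw j0 S' S''" "f \<in> S \<rightarrow> S'" "g \<in> S \<rightarrow> S'" "f \<in> extensional S" "g \<in> extensional S"
    "compose S j0 f = compose S j0 g"
  shows "f = g"
proof (rule extensionalityI[OF assms(4,5)])
  fix a assume a: "a \<in> S"
  then have "j0 (f a) = j0 (g a)" using fun_cong[OF assms(6), of a] by (simp add: compose_def)
  then show "f a = g a" using a assms(1-3) by (auto simp: bij_betw_def inj_on_def)
qed

text \<open>Composition with one fixed isomorphism from \<open>H\<close> to \<open>K\<close> is
  injective. The inequality is enough, as it can be applied in both directions.\<close>

lemma card_graph_isos_le:
  assumes G: "edge_bicolored_graph_on S T G" and H: "edge_bicolored_graph_on S' T' H"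
    and K: "edge_bicolored_graph_on S'' T'' K" and iso: "graph_isos H K \<noteq> {}"
  shows "card (graph_isos G H) \<le> card (graph_isos G K)"
proof -
  obtain j0 k0 where jk: "(j0, k0) \<in> graph_isos H K" using iso by auto
  let ?f = "\<lambda>(j, k). (compose S j0 j, compose T k0 k)"
  have "inj_on ?f (graph_isos G H)"
  proof (rule inj_onI, clarify)
    fix j k j' k'
    assume "(j, k) \<in> graph_isos G H" "(j', k') \<in> graph_isos G H"
      "compose S j0 j = compose S j0 j'" "compose T k0 k = compose T k0 k'"
    then show "j = j' \<and> k = k'"
      using jk compose_inj[of j0 S' S'' j S j'] compose_inj[of k0 T' T'' k T k']
      by (auto simp: mem_graph_isos_iff[OF G H] mem_graph_isos_iff[OF H K] bij_betw_imp_funcset)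
  qed
  moreover have "?f ` graph_isos G H \<subseteq> graph_isos G K"
    using graph_isos_compose[OF G H K _ jk] by auto
  ultimately show ?thesis using finite_graph_isos[OF G K] by (rule card_inj_on_le)
qed

text \<open>The isomorphisms from \<open>G\<close> to \<open>H\<close> form a torsor under the
  automorphism group of \<open>G\<close>, provided that there is one.\<close>

lemma card_graph_isos:
  assumes G: "edge_bicolored_graph_on S T G" and H: "edge_bicolored_graph_on S' T' H"
    and iso: "graph_isos G H \<noteq> {}"
  shows "card (graph_isos G H) = card (graph_auts G)"
proof -
  have "graph_isos H G \<noteq> {}" using iso graph_isos_inverse[OF G H] by auto
  then show ?thesis unfolding graph_auts_def
    using card_graph_isos_le[OF G H G] card_graph_isos_le[OF G G H iso] by simp
qed

lemma restrict_inv_into_inj: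
  assumes "bij_betw j S S'" "bij_betw j' S S'" "j \<in> extensional S" "j' \<in> extensional S"
    "restrict (inv_into S j) S' = restrict (inv_into S j') S'"
  shows "j = j'"
proof (rule extensionalityI[OF assms(3,4)])
  fix a assume a: "a \<in> S"
  have ja: "j a \<in> S'" "inv_into S j (j a) = a" using assms(1) a by (auto simp: bij_betw_def)
  then have "inv_into S j' (j a) = a" using fun_cong[OF assms(5), of "j a"] by simp
  then show "j a = j' a" using f_inv_into_f[of "j a" j' S] ja assms(2) by (auto simp: bij_betw_def)
qed

lemma card_graph_isos_swap_le:
  assumes G: "edge_bicolored_graph_on S T G" and H: "edge_bicolored_graph_on S' T' H"
  shows "card (graph_isos G H) \<le> card (graph_isos H G)"
proof -
  let ?f = "\<lambda>(j, k). (restrict (inv_into S j) S', restrict (inv_into T k) T')"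
  have "inj_on ?f (graph_isos G H)"
  proof (rule inj_onI, clarify)
    fix j k j' k'
    assume "(j, k) \<in> graph_isos G H" "(j', k') \<in> graph_isos G H"
      and "restrict (inv_into S j) S' = restrict (inv_into S j') S'"
        "restrict (inv_into T k) T' = restrict (inv_into T k') T'"
    then show "j = j' \<and> k = k'"
      using restrict_inv_into_inj[of j S S' j'] restrict_inv_into_inj[of k T T' k']
      by (simp add: mem_graph_isos_iff[OF G H])
  qed
  moreover have "?f ` graph_isos G H \<subseteq> graph_isos H G"
    using graph_isos_inverse[OF G H] by auto
  ultimately show ?thesis using finite_graph_isos[OF H G] by (rule card_inj_on_le)
qed

text \<open>\<open>graph_coeff\<close> evaluates the weight at an arbitrary representative, so the
  group order has to be constant on classes. Inversion matches the isomorphisms from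
  \<open>G\<close> to \<open>H\<close> with those from \<open>H\<close> to \<open>G\<close>, and
  these sets are as large as the two groups.\<close>

lemma card_graph_auts_cong:
  assumes G: "edge_bicolored_graph_on S T G" and H: "edge_bicolored_graph_on S' T' H"
    and iso: "graph_isos G H \<noteq> {}"
  shows "card (graph_auts G) = card (graph_auts H)"
proof -
  have "graph_isos H G \<noteq> {}" using iso graph_isos_inverse[OF G H] by auto
  then have "card (graph_auts G) = card (graph_isos G H)" "card (graph_auts H) = card (graph_isos H G)"
    using card_graph_isos[OF G H iso] card_graph_isos[OF H G] by simp_all
  then show ?thesis
    using card_graph_isos_swap_le[OF G H] card_graph_isos_swap_le[OF H G] by simp
qed

lemma bij_betw_relabel_vertex:
  assumes G: "edge_bicolored_graph_on S T G" and H: "edge_bicolored_graph_on S' T' H"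
    and iso: "(j, k) \<in> graph_isos G H"
  shows "bij_betw (relabel_vertex S T j k) (verts G) (verts H)"
    and "v \<in> verts G \<Longrightarrow> bidegree H (relabel_vertex S T j k v) = bidegree G v"
proof -
  note D = edge_bicolored_graph_onD[OF G] and D' = edge_bicolored_graph_onD[OF H]
  have j: "bij_betw j S S'" and k: "bij_betw k T T'" and eq: "relabel j k G = H"
    using iso by (auto simp: mem_graph_isos_iff[OF G H])
  have I: "relabel_vertex S T j k v \<inter> S' = j ` (v \<inter> S)" "relabel_vertex S T j k v \<inter> T' = k ` (v \<inter> T)" for v
    using j k D'(3) by (auto simp: relabel_vertex_def bij_betw_def)
  have "inj_on (relabel_vertex S T j k) (verts G)"
  proof (rule inj_onI)
    fix v w assume vw: "v \<in> verts G" "w \<in> verts G" "relabel_vertex S T j k v = relabel_vertex S T j k w"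
    have "j ` (v \<inter> S) = j ` (w \<inter> S)" "k ` (v \<inter> T) = k ` (w \<inter> T)" using I vw(3) by metis+
    then have "v \<inter> S = w \<inter> S" "v \<inter> T = w \<inter> T"
      using j k by (auto simp: bij_betw_def inj_on_image_eq_iff)
    then show "v = w" using verts_subset[OF G vw(1)] verts_subset[OF G vw(2)] by blast
  qed
  moreover have "verts H = relabel_vertex S T j k ` verts G"
    using eq by (auto simp: relabel_def D)
  ultimately show "bij_betw (relabel_vertex S T j k) (verts G) (verts H)" by (simp add: bij_betw_def)
  have "inj_on j (v \<inter> S)" "inj_on k (v \<inter> T)"
    using j k by (auto simp: bij_betw_def intro: inj_on_subset)
  then show "bidegree H (relabel_vertex S T j k v) = bidegree G v"
    by (simp add: bidegree_def D D' I card_image)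
qed

lemma prod_bidegree_cong:
  assumes G: "edge_bicolored_graph_on S T G" and H: "edge_bicolored_graph_on S' T' H"
    and iso: "graph_isos G H \<noteq> {}"
  shows "(\<Prod>v\<in>verts G. F (bidegree G v)) = (\<Prod>v\<in>verts H. F (bidegree H v))"
proof -
  obtain j k where jk: "(j, k) \<in> graph_isos G H" using iso by auto
  have "(\<Prod>v\<in>verts H. F (bidegree H v)) = (\<Prod>v\<in>verts G. F (bidegree H (relabel_vertex S T j k v)))"
    using bij_betw_relabel_vertex(1)[OF G H jk] by (rule prod.reindex_bij_betw[symmetric])
  also have "\<dots> = (\<Prod>v\<in>verts G. F (bidegree G v))"
    by (intro prod.cong refl) (simp only: bij_betw_relabel_vertex(2)[OF G H jk])
  finally show ?thesis by (rule sym)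
qed

lemma finite_graphs_on:
  fixes S T :: "'a set"
  shows "finite {G :: 'a bigraph. edge_bicolored_graph_on S T G}"
proof (cases "finite S \<and> finite T")
  case True
  let ?P = "Pow (Pow (S \<union> T))"
  have "{G :: 'a bigraph. edge_bicolored_graph_on S T G} \<subseteq>
    (\<lambda>(V, E, F). \<lparr>verts = V, red_edges = E, yellow_edges = F\<rparr>) ` (?P \<times> ?P \<times> ?P)"
  proof
    fix G :: "'a bigraph" assume "G \<in> {G. edge_bicolored_graph_on S T G}"
    then have "\<Union> (verts G) = S \<union> T \<and> \<Union> (red_edges G) = S \<and> \<Union> (yellow_edges G) = T"
      unfolding edge_bicolored_graph_on_def partition_on_def by blast
    then have "verts G \<in> ?P" "red_edges G \<in> ?P" "yellow_edges G \<in> ?P" by blast+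
    then show "G \<in> (\<lambda>(V, E, F). \<lparr>verts = V, red_edges = E, yellow_edges = F\<rparr>) ` (?P \<times> ?P \<times> ?P)"
      by (intro image_eqI[of _ _ "(verts G, red_edges G, yellow_edges G)"]) simp_all
  qed
  moreover have "finite ?P" using True by simp
  then have "finite ((\<lambda>(V, E, F). \<lparr>verts = V, red_edges = E, yellow_edges = F\<rparr>) ` (?P \<times> ?P \<times> ?P))"
    by (intro finite_imageI finite_cartesian_product)
  ultimately show ?thesis by (rule finite_subset)
next
  case False
  then have "{G :: 'a bigraph. edge_bicolored_graph_on S T G} = {}"
    unfolding edge_bicolored_graph_on_def by blast
  then show ?thesis by (metis finite.emptyI)
qed

text \<open>Orbit and stabilizer: every pair of permutations of \<open>S\<close> and
  \<open>T\<close> is an isomorphism from \<open>G\<close> to exactly one graph on the same labels,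
  so the sets \<open>graph_isos G H\<close> partition all pairs. By \<open>card_graph_isos\<close>
  each of them has the size of the automorphism group.\<close>

lemma card_graph_orbit:
  assumes G: "edge_bicolored_graph_on S T G"
  shows "card {H. edge_bicolored_graph_on S T H \<and> graph_isos G H \<noteq> {}} * card (graph_auts G) =
    fact (card S) * fact (card T)"
proof -
  note D = edge_bicolored_graph_onD[OF G]
  let ?O = "{H. edge_bicolored_graph_on S T H \<and> graph_isos G H \<noteq> {}}"
  let ?P = "\<lambda>S. {f \<in> S \<rightarrow>\<^sub>E S. inj_on f S}"
  have P: "f \<in> ?P A \<longleftrightarrow> f \<in> extensional A \<and> bij_betw f A A" if "finite A" for f and A :: "'a set"
    using that endo_inj_surj[of A f] by (auto simp: bij_betw_def PiE_def)
  have fO: "finite ?O" using finite_graphs_on[of S T] by (rule rev_finite_subset) auto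
  have "?P S \<times> ?P T = (\<Union>H\<in>?O. graph_isos G H)"
  proof (intro set_eqI iffI)
    fix p assume "p \<in> ?P S \<times> ?P T"
    then obtain j k where jk: "p = (j, k)" "j \<in> ?P S" "k \<in> ?P T" by auto
    have bij: "bij_betw j S S" "bij_betw k T T" "j \<in> extensional S" "k \<in> extensional T"
      using jk P D by blast+
    have R: "edge_bicolored_graph_on S T (relabel j k G)"
      by (rule edge_bicolored_graph_on_relabel[OF G bij(1,2) D(3)])
    then have "p \<in> graph_isos G (relabel j k G)"
      using bij unfolding jk by (simp add: mem_graph_isos_iff[OF G R])
    then show "p \<in> (\<Union>H\<in>?O. graph_isos G H)" using R by auto
  next
    fix p assume "p \<in> (\<Union>H\<in>?O. graph_isos G H)"
    then obtain H where H: "edge_bicolored_graph_on S T H" "p \<in> graph_isos G H" by auto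
    then show "p \<in> ?P S \<times> ?P T"
      using P D(1,2) by (cases p) (auto simp: mem_graph_isos_iff[OF G H(1)])
  qed
  then have "card (?P S \<times> ?P T) = card (\<Union>H\<in>?O. graph_isos G H)" by (rule arg_cong)
  then have "card (?P S) * card (?P T) = card (\<Union>H\<in>?O. graph_isos G H)"
    by (simp only: card_cartesian_product)
  also have "\<dots> = (\<Sum>H\<in>?O. card (graph_isos G H))"
  proof (rule card_UN_disjoint[OF fO])
    show "\<forall>H\<in>?O. finite (graph_isos G H)" using finite_graph_isos[OF G] by blast
    show "\<forall>H\<in>?O. \<forall>H'\<in>?O. H \<noteq> H' \<longrightarrow> graph_isos G H \<inter> graph_isos G H' = {}"
    proof (intro ballI impI equals0I)
      fix H H' p assume H: "H \<in> ?O" "H' \<in> ?O" "H \<noteq> H'" and p: "p \<in> graph_isos G H \<inter> graph_isos G H'"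
      obtain j k where "p = (j, k)" by fastforce
      then show False
        using H p mem_graph_isos_iff[OF G, of S T H j k] mem_graph_isos_iff[OF G, of S T H' j k] by auto
    qed
  qed
  also have "\<dots> = (\<Sum>H\<in>?O. card (graph_auts G))"
    using card_graph_isos[OF G] by (intro sum.cong) auto
  finally show ?thesis using card_injective_funcset[of S S] card_injective_funcset[of T T] D by simp
qed

lemma equiv_graph_iso_rel: "equiv {G. edge_bicolored_graph G} graph_iso_rel"
proof (rule equivI)
  show "graph_iso_rel \<subseteq> {G. edge_bicolored_graph G} \<times> {G. edge_bicolored_graph G}"
    by (auto simp: graph_iso_rel_def)
  show "refl_on {G. edge_bicolored_graph G} graph_iso_rel"
    unfolding refl_on_def graph_iso_rel_def edge_bicolored_graph_def
    using graph_isos_refl by fastforce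
  show "sym graph_iso_rel"
    unfolding sym_def graph_iso_rel_def edge_bicolored_graph_def
    using graph_isos_inverse by fastforce
  show "trans graph_iso_rel"
    unfolding trans_def graph_iso_rel_def edge_bicolored_graph_def
    using graph_isos_compose by fastforce
qed

text \<open>\<open>edges\<close> is a plain union, so the count also needs that no edge has both
  colours: such an edge would be a nonempty subset of \<open>S \<inter> T\<close>.\<close>

lemma card_edges:
  assumes G: "edge_bicolored_graph_on S T G"
  shows "2 * card (edges G) = card S + card T"
proof -
  note D = edge_bicolored_graph_onD[OF G]
  have *: "finite E \<and> card A = 2 * card E" if "E \<in> perfect_matchings A" "finite A" for E and A :: "'a set"
  proof -
    have E: "partition_on A E" "\<forall>e\<in>E. card e = 2" using that by (auto simp: perfect_matchings_def)
    have "card A = (\<Sum>e\<in>E. card e)" using E by (intro product_partition) (auto intro: card_ge_0_finite)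
    then show ?thesis using E that finite_elements[OF that(2) E(1)] by simp
  qed
  have "red_edges G \<inter> yellow_edges G = {}"
  proof (rule equals0I)
    fix e assume "e \<in> red_edges G \<inter> yellow_edges G"
    then have "e \<subseteq> S \<inter> T" "e \<noteq> {}" using D(5,6) by (auto simp: perfect_matchings_def partition_on_def)
    then show False using D(3) by auto
  qed
  then show ?thesis
    using *[OF D(5,1)] *[OF D(6,2)] by (simp add: edges_def card_Un_disjoint)
qed

lemma sum_vertex_degree:
  assumes G: "edge_bicolored_graph_on S T G"
  shows "(\<Sum>v\<in>verts G. vertex_degree G v) = card S + card T"
proof -
  note D = edge_bicolored_graph_onD[OF G]
  have "vertex_degree G v = card v" if "v \<in> verts G" for v
  proof -
    have v: "v = (v \<inter> S) \<union> (v \<inter> T)" using verts_subset[OF G that] by blast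
    have "card v = card (v \<inter> S) + card (v \<inter> T)"
      by (subst v, subst card_Un_disjoint) (use D(1-3) in auto)
    then show ?thesis by (simp add: vertex_degree_def bidegree_def D)
  qed
  then have "(\<Sum>v\<in>verts G. vertex_degree G v) = (\<Sum>v\<in>verts G. card v)" by simp
  also have "\<dots> = card (S \<union> T)"
    using D(1,2) verts_subset[OF G]
    by (intro product_partition[symmetric, OF D(4)]) (auto intro: finite_subset[of _ "S \<union> T"])
  finally show ?thesis using D(1-3) by (simp add: card_Un_disjoint)
qed

text \<open>Standard label sets for given numbers of half-edges. Every graph can be relabelled to
  them, and a graph determines its label sets and hence \<open>U\<close> and
  \<open>W\<close>.\<close>

definition labelled_graphs :: "nat \<Rightarrow> nat \<Rightarrow> nat \<Rightarrow> nat bigraph set" where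
  "labelled_graphs m U W = {G. edge_bicolored_graph_on {..<U} {U..<U + W} G \<and>
     card (verts G) = m \<and> (\<forall>v\<in>verts G. 3 \<le> vertex_degree G v)}"

lemma finite_labelled_graphs: "finite (labelled_graphs m U W)"
  unfolding labelled_graphs_def
  using finite_graphs_on[of "{..<U}" "{U..<U + W}"] by (rule rev_finite_subset) blast

text \<open>On fixed label sets a graph is a free choice of two matchings and a set partition.
  Bidegrees do not depend on the matchings, so these only contribute their number. The degree
  condition is encoded as a weight that vanishes below degree 3, which also supplies
  \<open>G' (0, 0) = 0\<close>.\<close>

lemma sum_labelled_graphs:
  "(\<Sum>G\<in>labelled_graphs m U W. \<Prod>v\<in>verts G. \<Lambda> (bidegree G v)) / (fact U * fact W) =
   real (matching_number U * matching_number W) / fact m *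
   (\<Sum>f\<in>degree_families m U W. \<Prod>i<m.
      (if 3 \<le> fst (f i) + snd (f i) then \<Lambda> (f i) else 0) / (fact (fst (f i)) * fact (snd (f i))))"
proof -
  define S T where "S = {..<U}" and "T = {U..<U + W}"
  have ST: "finite S" "finite T" "S \<inter> T = {}" "card S = U" "card T = W"
    by (auto simp: S_def T_def)
  define G' where "G' = (\<lambda>d :: nat \<times> nat. if 3 \<le> fst d + snd d then \<Lambda> d else 0)"
  define Q where "Q = {V. partition_on (S \<union> T) V \<and> card V = m}"
  define Q' where "Q' = {V \<in> Q. \<forall>v\<in>V. 3 \<le> card (v \<inter> S) + card (v \<inter> T)}"
  define F where "F = (\<lambda>V. \<Prod>v\<in>V. G' (card (v \<inter> S), card (v \<inter> T)))"
  let ?mk = "\<lambda>(V, E, E'). \<lparr>verts = V, red_edges = E, yellow_edges = E'\<rparr>"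
  let ?P = "perfect_matchings S \<times> perfect_matchings T"
  have fQ: "finite Q" unfolding Q_def
    using finitely_many_partition_on[of "S \<union> T"] ST by (intro finite_subset[OF _ finitely_many_partition_on[of "S \<union> T"]]) auto
  have "(\<Sum>G\<in>labelled_graphs m U W. \<Prod>v\<in>verts G. \<Lambda> (bidegree G v)) = (\<Sum>(V, p)\<in>Q' \<times> ?P. F V)"
  proof (rule sum.reindex_bij_witness[where i = ?mk and j = "\<lambda>G. (verts G, red_edges G, yellow_edges G)"])
    fix G assume "G \<in> labelled_graphs m U W"
    then have G: "edge_bicolored_graph_on S T G" "card (verts G) = m" "\<forall>v\<in>verts G. 3 \<le> vertex_degree G v"
      by (auto simp: labelled_graphs_def S_def T_def)
    note D = edge_bicolored_graph_onD[OF G(1)]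
    show "?mk (verts G, red_edges G, yellow_edges G) = G" by simp
    show "(verts G, red_edges G, yellow_edges G) \<in> Q' \<times> ?P"
      using D G(2,3) by (auto simp: Q'_def Q_def vertex_degree_def bidegree_def)
    show "(case (verts G, red_edges G, yellow_edges G) of (V, p) \<Rightarrow> F V) = (\<Prod>v\<in>verts G. \<Lambda> (bidegree G v))"
      using D G(3) by (auto simp: F_def G'_def vertex_degree_def bidegree_def intro!: prod.cong)
  next
    fix p assume "p \<in> Q' \<times> ?P"
    then obtain V E E' where p: "p = (V, E, E')" "V \<in> Q'" "E \<in> perfect_matchings S" "E' \<in> perfect_matchings T"
      by auto
    show "(verts (?mk p), red_edges (?mk p), yellow_edges (?mk p)) = p" by (simp add: p)
    have G: "edge_bicolored_graph_on S T (?mk p)"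
      using p ST by (simp add: edge_bicolored_graph_on_iff Q'_def Q_def)
    then show "?mk p \<in> labelled_graphs m U W"
      using p edge_bicolored_graph_onD(7,8)[OF G]
      by (auto simp: labelled_graphs_def S_def[symmetric] T_def[symmetric] Q'_def Q_def vertex_degree_def bidegree_def)
  qed
  also have "\<dots> = (\<Sum>V\<in>Q'. \<Sum>p\<in>?P. F V)" by (rule sum.cartesian_product[symmetric])
  also have "\<dots> = real (matching_number U * matching_number W) * (\<Sum>V\<in>Q'. F V)"
    using ST by (simp add: card_cartesian_product card_perfect_matchings sum_distrib_left)
  also have "(\<Sum>V\<in>Q'. F V) = (\<Sum>V\<in>Q. F V)"
  proof (rule sum.mono_neutral_left[OF fQ])
    show "\<forall>V\<in>Q - Q'. F V = 0"
    proof
      fix V assume V: "V \<in> Q - Q'"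
      then obtain v where v: "v \<in> V" "\<not> 3 \<le> card (v \<inter> S) + card (v \<inter> T)" by (auto simp: Q'_def)
      have "finite V" using V ST finite_elements[of "S \<union> T" V] by (auto simp: Q_def)
      then show "F V = 0" unfolding F_def G'_def using v by (intro prod_zero) auto
    qed
  qed (auto simp: Q'_def)
  finally have "(\<Sum>G\<in>labelled_graphs m U W. \<Prod>v\<in>verts G. \<Lambda> (bidegree G v)) / (fact U * fact W) =
     real (matching_number U * matching_number W) * ((\<Sum>V\<in>Q. F V) / (fact U * fact W))" by simp
  also have "(\<Sum>V\<in>Q. F V) / (fact U * fact W) = (\<Sum>f\<in>degree_families m U W.
      \<Prod>i<m. G' (f i) / (fact (fst (f i)) * fact (snd (f i)))) / fact m"
    using sum_partitions_bidegree[OF ST(1-3), of G' m] ST by (simp add: Q_def F_def G'_def)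
  finally show ?thesis by (simp add: G'_def)
qed

section \<open>Orbit counting\<close>

text \<open>The possible numbers of vertices, red and yellow half-edges in Euler characteristic
  \<open>-n\<close>: the \<open>(U + W) / 2\<close> edges exceed the \<open>m\<close> vertices by
  \<open>n\<close>, and minimal degree 3 forces \<open>m \<le> 2 * n\<close>.\<close>

definition graph_classes_sizes :: "nat \<Rightarrow> (nat \<times> nat \<times> nat) set" where
  "graph_classes_sizes n = (SIGMA m:{..2 * n}. {(U, W). U + W = 2 * (n + m)})"

lemma finite_graph_classes_sizes: "finite (graph_classes_sizes n)"
proof -
  have "{(U, W). U + W = 2 * (n + m)} \<subseteq> {..2 * (n + m)} \<times> {..2 * (n + m)}" for m by auto
  then have "finite {(U, W). U + W = 2 * (n + m)}" for m by (rule finite_subset) auto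
  then show ?thesis unfolding graph_classes_sizes_def by auto
qed

text \<open>An isomorphism class meets the set \<open>L\<close> of standardly labelled graphs in one
  orbit. By \<open>card_graph_orbit\<close> the weight of the class is the sum of \<open>wt\<close>
  over this orbit, so the sum over classes becomes a sum over all of \<open>L\<close>.\<close>

lemma graph_coeff_eq:
  "graph_coeff \<Lambda> n = (\<Sum>(m, U, W)\<in>graph_classes_sizes n.
     real (matching_number U * matching_number W) / fact m *
     (\<Sum>f\<in>degree_families m U W. \<Prod>i<m.
      (if 3 \<le> fst (f i) + snd (f i) then \<Lambda> (f i) else 0) / (fact (fst (f i)) * fact (snd (f i)))))"
proof -
  define X where "X = {G :: nat bigraph. edge_bicolored_graph G \<and> (\<forall>v\<in>verts G. 3 \<le> vertex_degree G v) \<and> euler_char G = - int n}"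
  define K where "K = graph_classes_sizes n"
  define L where "L = (\<Union>(m, U, W)\<in>K. labelled_graphs m U W)"
  define P where "P = (\<lambda>G :: nat bigraph. \<Prod>v\<in>verts G. \<Lambda> (bidegree G v))"
  define wt where "wt = (\<lambda>G :: nat bigraph. P G / (fact (card (red_halves G)) * fact (card (yellow_halves G))))"
  have Gs: "Gstar (- int n) = X // graph_iso_rel" by (simp add: Gstar_def X_def)
  have fK: "finite K" by (simp add: K_def finite_graph_classes_sizes)
  have fL: "finite L" unfolding L_def using fK by (auto intro!: finite_labelled_graphs)
  have LX: "G \<in> X" if "G \<in> L" for G
  proof -
    obtain m U W where K: "(m, U, W) \<in> K" and G: "edge_bicolored_graph_on {..<U} {U..<U + W} G"
      and m: "card (verts G) = m" and d: "\<forall>v\<in>verts G. 3 \<le> vertex_degree G v"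
      using \<open>G \<in> L\<close> by (auto simp: L_def labelled_graphs_def)
    have "2 * card (edges G) = U + W" using card_edges[OF G] by simp
    then show ?thesis using K G m d
      by (auto simp: X_def edge_bicolored_graph_def euler_char_def K_def graph_classes_sizes_def)
  qed
  have XL: "\<exists>H\<in>L. (G, H) \<in> graph_iso_rel" if "G \<in> X" for G
  proof -
    obtain S T where G: "edge_bicolored_graph_on S T G" using \<open>G \<in> X\<close> by (auto simp: X_def edge_bicolored_graph_def)
    note D = edge_bicolored_graph_onD[OF G]
    define U W m where "U = card S" and "W = card T" and "m = card (verts G)"
    obtain j where j: "bij_betw j S {..<U}"
      using D(1) unfolding U_def by (metis bij_betw_iff_card card_lessThan finite_lessThan)
    have "card T = card {U..<U + W}" by (simp add: W_def)
    then obtain k where k: "bij_betw k T {U..<U + W}"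
      using D(2) finite_same_card_bij by blast
    have H: "edge_bicolored_graph_on {..<U} {U..<U + W} (relabel j k G)"
      by (rule edge_bicolored_graph_on_relabel[OF G j k]) auto
    have H': "relabel (restrict j S) (restrict k T) G = relabel j k G"
      by (rule relabel_restrict[OF G])
    have iso: "(restrict j S, restrict k T) \<in> graph_isos G (relabel j k G)"
      using j k H' by (simp add: mem_graph_isos_iff[OF G H])
    note B = bij_betw_relabel_vertex[OF G H iso]
    have e: "2 * card (edges G) = U + W" using card_edges[OF G] by (simp add: U_def W_def)
    have "int (n + m) = int (card (edges G))" using that by (simp add: X_def euler_char_def m_def)
    then have "n + m = card (edges G)" by (rule of_nat_eq_iff[THEN iffD1])
    then have UW: "U + W = 2 * (n + m)" using e by simp
    have "3 * m \<le> (\<Sum>v\<in>verts G. vertex_degree G v)"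
      using sum_bounded_below[of "verts G" 3 "vertex_degree G"] that by (simp add: X_def m_def mult.commute)
    then have "3 * m \<le> U + W" using sum_vertex_degree[OF G] by (simp add: U_def W_def)
    then have mn: "m \<le> 2 * n" using UW by simp
    have "card (verts (relabel j k G)) = m" using bij_betw_same_card[OF B(1)] by (simp add: m_def)
    moreover have "3 \<le> vertex_degree (relabel j k G) v" if "v \<in> verts (relabel j k G)" for v
    proof -
      obtain w where "w \<in> verts G" "v = relabel_vertex S T (restrict j S) (restrict k T) w"
        using B(1) \<open>v \<in> _\<close> by (auto simp: bij_betw_def)
      then show ?thesis using B(2)[of w] \<open>G \<in> X\<close> by (simp add: X_def vertex_degree_def)
    qed
    ultimately have "relabel j k G \<in> L"
      using UW mn H unfolding L_def K_def graph_classes_sizes_def labelled_graphs_def by fastforce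
    moreover have "(G, relabel j k G) \<in> graph_iso_rel"
      using G H iso unfolding graph_iso_rel_def edge_bicolored_graph_def by auto
    ultimately show ?thesis by blast
  qed
  have equivX: "graph_iso_rel `` {G} = graph_iso_rel `` {H} \<longleftrightarrow> (G, H) \<in> graph_iso_rel"
    if "G \<in> X" "H \<in> X" for G H
    using that by (intro eq_equiv_class_iff[OF equiv_graph_iso_rel]) (auto simp: X_def)
  have GsL: "Gstar (- int n) = (\<lambda>G. graph_iso_rel `` {G}) ` L"
  proof -
    have "graph_iso_rel `` {G} \<in> (\<lambda>G. graph_iso_rel `` {G}) ` L" if "G \<in> X" for G
      using XL[OF that] equivX LX that by blast
    then show ?thesis using LX unfolding Gs quotient_def by blast
  qed
  have class_sum: "graph_weight \<Lambda> (SOME G. G \<in> C) = (\<Sum>G\<in>{G\<in>L. graph_iso_rel `` {G} = C}. wt G)"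
    if C: "C \<in> Gstar (- int n)" for C
  proof -
    obtain G where G: "G \<in> L" "C = graph_iso_rel `` {G}" using C GsL by auto
    obtain m U W where K: "(m, U, W) \<in> K" and GL: "G \<in> labelled_graphs m U W"
      using G by (auto simp: L_def)
    define S T where "S = {..<U}" and "T = {U..<U + W}"
    have Gon: "edge_bicolored_graph_on S T G" using GL by (simp add: labelled_graphs_def S_def T_def)
    have "G \<in> C" using LX[OF G(1)] G(2) equiv_class_self[OF equiv_graph_iso_rel, of G] by (auto simp: X_def)
    \<comment> \<open>The chosen representative may carry labels other than those of
      \<open>G\<close>, so automorphisms and weights are transported to \<open>G\<close> along an
      isomorphism.\<close>
    define R where "R = (SOME G. G \<in> C)"
    have "R \<in> C" unfolding R_def using \<open>G \<in> C\<close> by (rule someI)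
    then have R: "edge_bicolored_graph R" "graph_isos G R \<noteq> {}"
      by (simp_all add: G graph_iso_rel_def)
    obtain S' T' where Ron: "edge_bicolored_graph_on S' T' R" using R(1) by (auto simp: edge_bicolored_graph_def)
    have RG: "graph_isos R G \<noteq> {}" using R(2) graph_isos_inverse[OF Gon Ron] by auto
    have aut: "card (graph_auts R) = card (graph_auts G)"
      by (rule card_graph_auts_cong[OF Ron Gon RG])
    have prd: "P R = P G" unfolding P_def by (rule prod_bidegree_cong[OF Ron Gon RG])
    define N where "N = {H. edge_bicolored_graph_on S T H \<and> graph_isos G H \<noteq> {}}"
    \<comment> \<open>Standard label sets are determined by their cardinalities, so the members of
      \<open>L\<close> isomorphic to \<open>G\<close> all live on the same \<open>S\<close> and
      \<open>T\<close>.\<close>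
    have NC: "{H\<in>L. graph_iso_rel `` {H} = C} = N"
    proof (intro set_eqI iffI)
      fix H assume H: "H \<in> {H\<in>L. graph_iso_rel `` {H} = C}"
      then have "(G, H) \<in> graph_iso_rel" using equivX[OF LX[OF G(1)], of H] LX G(2) by auto
      then have iso: "graph_isos G H \<noteq> {}" by (simp add: graph_iso_rel_def)
      obtain m' U' W' where H': "edge_bicolored_graph_on {..<U'} {U'..<U' + W'} H"
        using H by (auto simp: L_def labelled_graphs_def)
      obtain j k where "(j, k) \<in> graph_isos G H" using iso by auto
      then have "bij_betw j S {..<U'}" "bij_betw k T {U'..<U' + W'}"
        by (auto simp: mem_graph_isos_iff[OF Gon H'])
      then have "U' = U" "W' = W" using bij_betw_same_card by (fastforce simp: S_def T_def)+
      then show "H \<in> N" using iso H' by (simp add: N_def S_def T_def)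
    next
      fix H assume H: "H \<in> N"
      then have Hon: "edge_bicolored_graph_on S T H" and iso: "graph_isos G H \<noteq> {}" by (auto simp: N_def)
      obtain j k where jk: "(j, k) \<in> graph_isos G H" using iso by auto
      note B = bij_betw_relabel_vertex[OF Gon Hon jk]
      have "card (verts H) = m" using bij_betw_same_card[OF B(1)] GL by (simp add: labelled_graphs_def)
      moreover have "3 \<le> vertex_degree H v" if "v \<in> verts H" for v
      proof -
        obtain w where "w \<in> verts G" "v = relabel_vertex S T j k w"
          using B(1) \<open>v \<in> _\<close> by (auto simp: bij_betw_def)
        then show ?thesis using B(2)[of w] GL by (simp add: labelled_graphs_def vertex_degree_def)
      qed
      ultimately have "H \<in> labelled_graphs m U W" using Hon by (simp add: labelled_graphs_def S_def T_def)
      then have HL: "H \<in> L" using K by (auto simp: L_def)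
      moreover have "(G, H) \<in> graph_iso_rel"
        using Gon Hon iso unfolding graph_iso_rel_def edge_bicolored_graph_def by auto
      ultimately show "H \<in> {H\<in>L. graph_iso_rel `` {H} = C}"
        using equivX[OF LX[OF G(1)] LX[OF HL]] G(2) by simp
    qed
    have wtN: "wt H = P G / (fact U * fact W)" if "H \<in> N" for H
    proof -
      have Hon: "edge_bicolored_graph_on S T H" and iso: "graph_isos G H \<noteq> {}" using that by (auto simp: N_def)
      have "P G = P H" unfolding P_def by (rule prod_bidegree_cong[OF Gon Hon iso])
      then show ?thesis using edge_bicolored_graph_onD(7,8)[OF Hon] by (simp add: wt_def S_def T_def)
    qed
    have orb: "real (card N) * real (card (graph_auts G)) = fact U * fact W"
    proof -
      have "card N * card (graph_auts G) = fact U * fact W"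
        using card_graph_orbit[OF Gon] by (simp add: N_def S_def T_def)
      then show ?thesis by (metis of_nat_fact of_nat_mult)
    qed
    \<comment> \<open>A factor of a product of factorials cannot vanish; this allows the division
      below.\<close>
    then have "card (graph_auts G) \<noteq> 0" by (metis fact_nonzero mult_eq_0_iff of_nat_0)
    have "(\<Sum>H\<in>N. wt H) = real (card N) * (P G / (fact U * fact W))" using wtN by simp
    also have "\<dots> = P G / real (card (graph_auts G))"
      unfolding orb[symmetric] using orb \<open>card (graph_auts G) \<noteq> 0\<close> by (auto simp: field_simps)
    also have "\<dots> = graph_weight \<Lambda> R" using aut prd by (simp add: graph_weight_def P_def)
    finally show ?thesis using NC by (simp add: R_def)
  qed
  have "graph_coeff \<Lambda> n = (\<Sum>C\<in>Gstar (- int n). \<Sum>G\<in>{G\<in>L. graph_iso_rel `` {G} = C}. wt G)"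
    unfolding graph_coeff_def using class_sum by (rule sum.cong[OF refl])
  also have "\<dots> = (\<Sum>G\<in>L. wt G)"
    using fL GsL by (intro sum.group) auto
  also have "\<dots> = (\<Sum>k\<in>K. \<Sum>G\<in>(case k of (m, U, W) \<Rightarrow> labelled_graphs m U W). wt G)"
    unfolding L_def
  proof (rule sum.UNION_disjoint[OF fK])
    show "\<forall>k\<in>K. finite (case k of (m, U, W) \<Rightarrow> labelled_graphs m U W)" by (auto intro: finite_labelled_graphs)
    show "\<forall>k\<in>K. \<forall>l\<in>K. k \<noteq> l \<longrightarrow> (case k of (m, U, W) \<Rightarrow> labelled_graphs m U W) \<inter> (case l of (m, U, W) \<Rightarrow> labelled_graphs m U W) = {}"
    proof (intro ballI impI equals0I)
      fix k l G assume kl: "k \<noteq> l"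
        and G: "G \<in> (case k of (m, U, W) \<Rightarrow> labelled_graphs m U W) \<inter> (case l of (m, U, W) \<Rightarrow> labelled_graphs m U W)"
      obtain m U W m' U' W' where [simp]: "k = (m, U, W)" "l = (m', U', W')" by (cases k, cases l) auto
      have a: "edge_bicolored_graph_on {..<U} {U..<U + W} G" and b: "edge_bicolored_graph_on {..<U'} {U'..<U' + W'} G"
        and "m = m'" using G by (auto simp: labelled_graphs_def)
      moreover have "{..<U} = {..<U'}" "{U..<U + W} = {U'..<U' + W'}"
        using edge_bicolored_graph_onD(7,8)[OF a] edge_bicolored_graph_onD(7,8)[OF b] by auto
      then have "card {..<U} = card {..<U'}" "card {U..<U + W} = card {U'..<U' + W'}" by simp_all
      ultimately show False using kl by simp
    qed
  qed
  also have "\<dots> = (\<Sum>(m, U, W)\<in>K. (\<Sum>G\<in>labelled_graphs m U W. P G) / (fact U * fact W))"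
  proof (intro sum.cong[OF refl], clarify)
    fix m U W
    have "wt G = P G / (fact U * fact W)" if "G \<in> labelled_graphs m U W" for G
      using that edge_bicolored_graph_onD(7,8)[of "{..<U}" "{U..<U + W}" G] by (simp add: wt_def labelled_graphs_def)
    then show "(\<Sum>G\<in>labelled_graphs m U W. wt G) = (\<Sum>G\<in>labelled_graphs m U W. P G) / (fact U * fact W)"
      by (simp add: sum_divide_distrib)
  qed
  finally show ?thesis unfolding P_def sum_labelled_graphs K_def .
qed

section \<open>Gaussian moments\<close>

lemma matching_number_even: "real (matching_number (2 * k)) = fact (2 * k) / (2 ^ k * fact k)"
proof (induction k)
  case (Suc k)
  have "2 * Suc k = Suc (Suc (2 * k))" by simp
  then have "real (matching_number (2 * Suc k)) = real (Suc (2 * k)) * (fact (2 * k) / (2 ^ k * fact k))"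
    by (simp only: matching_number.simps of_nat_mult Suc.IH)
  also have "\<dots> = fact (2 * Suc k) / (2 ^ Suc k * fact (Suc k))"
  proof -
    define F :: real where "F = fact (2 * k)"
    define E :: real where "E = 2 ^ k * fact k"
    have "fact (2 * Suc k) = (2 * (real k + 1)) * ((2 * real k + 1) * F)" "2 ^ Suc k * fact (Suc k) = (2 * (real k + 1)) * E"
      by (simp_all add: F_def E_def algebra_simps)
    then show ?thesis unfolding F_def[symmetric] E_def[symmetric] by (simp add: add.commute)
  qed
  finally show ?case .
qed simp

lemma matching_number_odd: "odd n \<Longrightarrow> matching_number n = 0"
  by (induction n rule: matching_number.induct) auto

text \<open>The integrand is \<open>sqrt (2 * pi / z)\<close> times a moment of the normal
  distribution of variance \<open>1 / z\<close>. For odd \<open>a\<close> the moment and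
  \<open>matching_number a\<close> are both 0, so the rounding in \<open>a div 2\<close> is
  harmless.\<close>

lemma gaussian_moment:
  fixes z :: real
  assumes z: "z > 0"
  shows "has_bochner_integral lborel (\<lambda>x. x ^ a * exp (- (z * x\<^sup>2 / 2)))
           (sqrt (2 * pi / z) * (matching_number a / z ^ (a div 2)))"
proof -
  have dens: "normal_density 0 (1 / sqrt z) x = exp (- (z * x\<^sup>2 / 2)) / sqrt (2 * pi / z)" for x
    using z by (simp add: normal_density_def power_divide field_simps)
  have s: "1 / sqrt z > 0" using z by simp
  have sq: "sqrt (2 * pi / z) \<noteq> 0" using z by simp
  have "has_bochner_integral lborel (\<lambda>x. normal_density 0 (1 / sqrt z) x * x ^ a) (matching_number a / z ^ (a div 2))"
  proof (cases "even a")
    case True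
    then obtain k where a: "a = 2 * k" by auto
    have "fact (2 * k) / ((2 / (1 / sqrt z)\<^sup>2) ^ k * fact k) = real (matching_number a) / z ^ (a div 2)"
      using z unfolding a matching_number_even by (simp add: power_divide field_simps)
    then show ?thesis using normal_moment_even[OF s, of 0 k] by (simp add: a)
  next
    case False
    then obtain k where a: "a = 2 * k + 1" by (auto elim: oddE)
    show ?thesis using normal_moment_odd[OF s, of 0 k] False by (simp add: a matching_number_odd)
  qed
  from has_bochner_integral_mult_right[OF this, of "sqrt (2 * pi / z)"] sq
  show ?thesis by (simp add: dens field_simps)
qed

section \<open>Moments over the plane\<close>

lemma has_bochner_integral_pair:
  fixes f g :: "real \<Rightarrow> real"
  assumes f: "has_bochner_integral lborel f a" and g: "has_bochner_integral lborel g b"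
  shows "has_bochner_integral lborel (\<lambda>p. f (fst p) * g (snd p)) (a * b)"
proof -
  have fi: "integrable lborel f" and gi: "integrable lborel g" using f g by (auto simp: has_bochner_integral_iff)
  have "integrable (lborel \<Otimes>\<^sub>M lborel) (\<lambda>(x, y). f x * g y)"
  proof (rule lborel_pair.Fubini_integrable)
    show "(\<lambda>(x, y). f x * g y) \<in> borel_measurable (lborel \<Otimes>\<^sub>M lborel)"
      using borel_measurable_integrable[OF fi] borel_measurable_integrable[OF gi] by measurable
    have "(\<integral>y. norm (case (x, y) of (x, y) \<Rightarrow> f x * g y) \<partial>lborel) = norm (f x) * (\<integral>y. norm (g y) \<partial>lborel)" for x
      by (simp add: abs_mult)
    then show "integrable lborel (\<lambda>x. \<integral>y. norm (case (x, y) of (x, y) \<Rightarrow> f x * g y) \<partial>lborel)"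
      using fi by (simp add: integrable_norm)
    show "AE x in lborel. integrable lborel (\<lambda>y. case (x, y) of (x, y) \<Rightarrow> f x * g y)"
      using gi by simp
  qed
  moreover from lborel_pair.integral_fst'[OF this]
  have "(\<integral>p. (case p of (x, y) \<Rightarrow> f x * g y) \<partial>(lborel \<Otimes>\<^sub>M lborel)) = a * b"
    using f g by (simp add: has_bochner_integral_iff)
  ultimately show ?thesis by (simp add: has_bochner_integral_iff lborel_prod split_beta')
qed

lemma has_bochner_integral_lebesgue:
  fixes f :: "'a::euclidean_space \<Rightarrow> real"
  assumes "has_bochner_integral lborel f a"
  shows "has_bochner_integral lebesgue f a"
  using assms borel_measurable_integrable[of lborel f]
  by (auto simp: has_bochner_integral_iff integrable_completion integral_completion)

lemma norm_prod_sq: "(norm (p :: real \<times> real))\<^sup>2 = (fst p)\<^sup>2 + (snd p)\<^sup>2"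
  by (cases p) (simp add: norm_Pair)

lemma gaussian_moment_plane:
  fixes z :: real
  assumes z: "z > 0"
  shows "has_bochner_integral lebesgue (\<lambda>p. fst p ^ a * snd p ^ b * exp (- (z * (norm p)\<^sup>2 / 2)))
           (2 * pi / z * (real (matching_number a * matching_number b) / z ^ ((a + b) div 2)))"
proof -
  have "sqrt (2 * pi / z) * (matching_number a / z ^ (a div 2)) * (sqrt (2 * pi / z) * (matching_number b / z ^ (b div 2)))
    = 2 * pi / z * (real (matching_number a * matching_number b) / z ^ ((a + b) div 2))"
  \<comment> \<open>If both exponents are odd, \<open>(a + b) div 2\<close> differs from the sum of
    the halves, but as soon as one is odd both sides vanish.\<close>
  proof (cases "even a \<and> even b")
    case True
    then have "(a + b) div 2 = a div 2 + b div 2" by auto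
    moreover have "sqrt (2 * pi / z) * sqrt (2 * pi / z) = 2 * pi / z" using z by simp
    ultimately show ?thesis by (simp add: power_add mult_ac times_divide_times_eq)
  qed (auto simp: matching_number_odd)
  moreover have "(\<lambda>p. fst p ^ a * snd p ^ b * exp (- (z * (norm p)\<^sup>2 / 2))) =
    (\<lambda>p :: real \<times> real. fst p ^ a * exp (- (z * (fst p)\<^sup>2 / 2)) * (snd p ^ b * exp (- (z * (snd p)\<^sup>2 / 2))))"
  proof
    fix p :: "real \<times> real"
    have "- (z * (norm p)\<^sup>2 / 2) = - (z * (fst p)\<^sup>2 / 2) + - (z * (snd p)\<^sup>2 / 2)"
      by (simp add: norm_prod_sq field_simps)
    then have "exp (- (z * (norm p)\<^sup>2 / 2)) = exp (- (z * (fst p)\<^sup>2 / 2)) * exp (- (z * (snd p)\<^sup>2 / 2))"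
      by (simp only: exp_add)
    then show "fst p ^ a * snd p ^ b * exp (- (z * (norm p)\<^sup>2 / 2)) =
      fst p ^ a * exp (- (z * (fst p)\<^sup>2 / 2)) * (snd p ^ b * exp (- (z * (snd p)\<^sup>2 / 2)))"
      by (simp only: mult_ac)
  qed
  ultimately show ?thesis
    using has_bochner_integral_lebesgue[OF has_bochner_integral_pair[OF gaussian_moment[OF z, of a] gaussian_moment[OF z, of b]]]
    by simp
qed

text \<open>Integrates the dominating functions. An even power of the norm is a binomial sum of
  monomials in the squared coordinates, and the exponent belongs to the Gaussian of parameter
  \<open>z / 2\<close>, whence the factor \<open>2 ^ Suc k\<close>.\<close>

lemma gaussian_radial_moment:
  fixes k :: nat
  obtains C where "C \<ge> 0" "\<And>z. z > 0 \<Longrightarrow> has_bochner_integral lebesgue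
     (\<lambda>p :: real \<times> real. norm p ^ (2 * k) * exp (- (z * (norm p)\<^sup>2 / 4))) (C / z ^ Suc k)"
proof
  let ?C = "(\<Sum>i\<le>k. real (k choose i) * (2 * pi * real (matching_number (2 * i) * matching_number (2 * (k - i))))) * 2 ^ Suc k"
  show "?C \<ge> 0" by (intro mult_nonneg_nonneg sum_nonneg) auto
  fix z :: real assume z: "z > 0"
  have eq: "norm p ^ (2 * k) * exp (- (z * (norm p)\<^sup>2 / 4)) =
    (\<Sum>i\<le>k. real (k choose i) * (fst p ^ (2 * i) * snd p ^ (2 * (k - i)) * exp (- (z / 2 * (norm p)\<^sup>2 / 2))))"
    for p :: "real \<times> real"
  proof -
    have "norm p ^ (2 * k) = (\<Sum>i\<le>k. real (k choose i) * (fst p)\<^sup>2 ^ i * (snd p)\<^sup>2 ^ (k - i))"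
      unfolding power_mult norm_prod_sq binomial_ring ..
    moreover have "exp (- (z / 2 * (norm p)\<^sup>2 / 2)) = exp (- (z * (norm p)\<^sup>2 / 4))" by simp
    ultimately show ?thesis by (simp only: sum_distrib_right power_mult mult.assoc)
  qed
  have "has_bochner_integral lebesgue (\<lambda>p. \<Sum>i\<le>k. real (k choose i) * (fst p ^ (2 * i) * snd p ^ (2 * (k - i)) * exp (- (z / 2 * (norm p)\<^sup>2 / 2))))
    (\<Sum>i\<le>k. real (k choose i) * (2 * pi / (z / 2) * (real (matching_number (2 * i) * matching_number (2 * (k - i))) / (z / 2) ^ ((2 * i + 2 * (k - i)) div 2))))"
    using z by (intro has_bochner_integral_sum has_bochner_integral_mult_right gaussian_moment_plane) auto
  also have "(\<Sum>i\<le>k. real (k choose i) * (2 * pi / (z / 2) * (real (matching_number (2 * i) * matching_number (2 * (k - i))) / (z / 2) ^ ((2 * i + 2 * (k - i)) div 2))))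
    = (\<Sum>i\<le>k. real (k choose i) * (2 * pi * real (matching_number (2 * i) * matching_number (2 * (k - i)))) * (2 ^ Suc k / z ^ Suc k))"
  proof (rule sum.cong[OF refl])
    fix i assume "i \<in> {..k}"
    then have "(2 * i + 2 * (k - i)) div 2 = k" by simp
    then show "real (k choose i) * (2 * pi / (z / 2) * (real (matching_number (2 * i) * matching_number (2 * (k - i))) / (z / 2) ^ ((2 * i + 2 * (k - i)) div 2)))
      = real (k choose i) * (2 * pi * real (matching_number (2 * i) * matching_number (2 * (k - i)))) * (2 ^ Suc k / z ^ Suc k)"
      using z by (simp add: power_divide)
  qed
  also have "\<dots> = ?C / z ^ Suc k" by (simp only: sum_distrib_right sum_divide_distrib times_divide_eq_right)
  finally show "has_bochner_integral lebesgue
     (\<lambda>p :: real \<times> real. norm p ^ (2 * k) * exp (- (z * (norm p)\<^sup>2 / 4))) (?C / z ^ Suc k)"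
    unfolding eq .
qed

section \<open>Elementary estimates for the exponential function\<close>

lemma exp_Taylor_bound:
  fixes x :: real
  shows "\<bar>exp x - (\<Sum>m<n. x ^ m / fact m)\<bar> \<le> \<bar>x\<bar> ^ n * exp \<bar>x\<bar>"
proof -
  obtain t where t: "\<bar>t\<bar> \<le> \<bar>x\<bar>" "exp x = (\<Sum>m<n. x ^ m / fact m) + exp t / fact n * x ^ n"
    using Maclaurin_exp_le by blast
  have "\<bar>exp x - (\<Sum>m<n. x ^ m / fact m)\<bar> = exp t / fact n * \<bar>x\<bar> ^ n"
    using t by (simp add: abs_mult power_abs)
  also have "\<dots> \<le> exp \<bar>x\<bar> * \<bar>x\<bar> ^ n"
  proof (rule mult_right_mono)
    have "exp t / fact n \<le> exp t" by (simp add: divide_le_eq fact_ge_1)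
    also have "\<dots> \<le> exp \<bar>x\<bar>" using t by simp
    finally show "exp t / fact n \<le> exp \<bar>x\<bar>" .
  qed simp
  finally show ?thesis by (simp add: mult.commute)
qed

lemma exp_diff_bound:
  fixes a b c :: real
  assumes "\<bar>a\<bar> \<le> c" "\<bar>b\<bar> \<le> c"
  shows "\<bar>exp a - exp b\<bar> \<le> \<bar>a - b\<bar> * exp c"
proof -
  have *: "exp a - exp b \<le> \<bar>a - b\<bar> * exp c" if "\<bar>a\<bar> \<le> c" "b \<le> a" for a b :: real
  proof -
    have "exp a - exp b = exp a * (1 - exp (b - a))" by (simp add: algebra_simps exp_diff)
    also have "\<dots> \<le> exp a * (a - b)" using exp_ge_add_one_self[of "b - a"] by (intro mult_left_mono) (auto simp: algebra_simps)
    also have "\<dots> \<le> exp c * (a - b)" using that by (intro mult_right_mono) auto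
    finally show ?thesis using that by (simp add: mult.commute)
  qed
  show ?thesis
  proof (cases "b \<le> a")
    case True
    then show ?thesis using *[of a b] assms by simp
  next
    case False
    then show ?thesis using *[of b a] assms by (simp add: abs_minus_commute)
  qed
qed

text \<open>The exponential series dominates its single term of degree \<open>n\<close>. The
  exponent has \<open>z - 1\<close> instead of \<open>z\<close> because, away from the origin, one
  factor \<open>exp (g p)\<close> has to be kept as an integrable bound.\<close>

lemma power_exp_decay:
  fixes z d :: real
  assumes "d > 0" "z \<ge> 0"
  shows "z ^ n * exp (- (z - 1) * d) \<le> fact n / d ^ n * exp d"
proof -
  have "(d * z) ^ n / fact n \<le> exp (d * z)"
    using sum_le_suminf[OF summable_exp_generic[of "d * z"], of "{n}"] assms
    by (simp add: exp_def divide_inverse mult.commute)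
  then have "z ^ n \<le> fact n / d ^ n * exp (d * z)" using assms by (simp add: field_simps power_mult_distrib)
  then have "z ^ n * exp (- (z - 1) * d) \<le> fact n / d ^ n * exp (d * z) * exp (- (z - 1) * d)"
    by (intro mult_right_mono) auto
  also have "\<dots> = fact n / d ^ n * exp d" by (simp add: algebra_simps flip: exp_add)
  finally show ?thesis .
qed

section \<open>Laplace's method\<close>

definition degrees_below :: "nat \<Rightarrow> (nat \<times> nat) set" where
  "degrees_below L = {d. 3 \<le> fst d + snd d \<and> fst d + snd d < L}"

definition taylor_poly :: "(nat \<times> nat \<Rightarrow> real) \<Rightarrow> nat \<Rightarrow> real \<times> real \<Rightarrow> real" where
  "taylor_poly c L p = (\<Sum>d\<in>degrees_below L. c d * (fst p ^ fst d * snd p ^ snd d))"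

lemma finite_degrees_below: "finite (degrees_below L)"
proof (rule finite_subset)
  show "degrees_below L \<subseteq> {..L} \<times> {..L}" by (auto simp: degrees_below_def)
qed auto

lemma abs_monomial_le: "\<bar>fst p ^ u * snd p ^ w\<bar> \<le> norm (p :: real \<times> real) ^ (u + w)"
proof -
  have "\<bar>fst p\<bar> ^ u * \<bar>snd p\<bar> ^ w \<le> norm p ^ u * norm p ^ w"
    using norm_fst_le[of "fst p" "snd p"] norm_snd_le[of "snd p" "fst p"]
    by (intro mult_mono power_mono) auto
  then show ?thesis by (simp add: abs_mult power_abs power_add)
qed

text \<open>Over the reals \<open>has_sum\<close> implies absolute summability, so convergence at
  the single point \<open>(\<rho>, \<rho>)\<close> makes \<open>B\<close>, the sum of
  \<open>\<bar>c d\<bar> * \<rho> ^ (fst d + snd d)\<close>, finite. For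
  \<open>norm p \<le> \<rho>\<close> a term of degree at least \<open>L\<close> is at most
  \<open>(norm p / \<rho>) ^ L\<close> times the corresponding term of \<open>B\<close>. Neither
  constant depends on \<open>L\<close>.\<close>

lemma taylor_remainder:
  assumes ev: "\<forall>\<^sub>F p in nhds (0 :: real \<times> real).
    ((\<lambda>d. c d * (fst p ^ fst d * snd p ^ snd d)) has_sum (h p :: real)) {d. 3 \<le> fst d + snd d}"
  obtains \<rho> B where "\<rho> > 0" "B \<ge> 0"
    "\<And>p L. norm p \<le> \<rho> \<Longrightarrow> \<bar>h p - taylor_poly c L p\<bar> \<le> B * (norm p / \<rho>) ^ L"
proof -
  let ?I = "{d :: nat \<times> nat. 3 \<le> fst d + snd d}"
  obtain r0 where r0: "r0 > 0" and hs: "\<And>p. norm p < r0 \<Longrightarrow>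
    ((\<lambda>d. c d * (fst p ^ fst d * snd p ^ snd d)) has_sum h p) ?I"
    using ev unfolding eventually_nhds_metric by (auto simp: dist_norm)
  \<comment> \<open>Halving leaves room for the corner \<open>(\<rho>, \<rho>)\<close>, whose norm
    is \<open>sqrt 2 * \<rho>\<close>.\<close>
  define \<rho> where "\<rho> = r0 / 2"
  have rho: "\<rho> > 0" "\<rho> < r0" using r0 by (auto simp: \<rho>_def)
  define b where "b = (\<lambda>d. \<bar>c d\<bar> * \<rho> ^ (fst d + snd d))"
  define B where "B = infsum b ?I"
  have "norm (\<rho>, \<rho>) < r0"
  proof -
    have "norm (\<rho>, \<rho>) = sqrt 2 * \<rho>" using rho by (simp add: norm_Pair real_sqrt_mult)
    also have "\<dots> < 2 * \<rho>" using rho sqrt2_less_2 by simp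
    finally show ?thesis by (simp add: \<rho>_def)
  qed
  from hs[OF this] have "(\<lambda>d. c d * (\<rho> ^ fst d * \<rho> ^ snd d)) summable_on ?I"
    by (auto simp: summable_on_def)
  then have "(\<lambda>d. norm (c d * (\<rho> ^ fst d * \<rho> ^ snd d))) summable_on ?I"
    by (rule summable_on_iff_abs_summable_on_real[THEN iffD1])
  then have bs: "b summable_on ?I" using rho by (simp add: b_def abs_mult power_add)
  have b0: "b d \<ge> 0" for d using rho by (simp add: b_def)
  have B0: "B \<ge> 0" unfolding B_def by (rule infsum_nonneg) (rule b0)
  have "\<bar>h p - taylor_poly c L p\<bar> \<le> B * (norm p / \<rho>) ^ L" if p: "norm p \<le> \<rho>" for p L
  proof -
    let ?J = "?I - degrees_below L"
    let ?f = "\<lambda>d. c d * (fst p ^ fst d * snd p ^ snd d)"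
    have f: "(?f has_sum (h p - taylor_poly c L p)) ?J"
      unfolding taylor_poly_def
      using hs[of p] p rho by (intro has_sum_Diff has_sum_finite finite_degrees_below) (auto simp: degrees_below_def)
    have "b summable_on ?J" using bs by (rule summable_on_subset_banach) auto
    then have bJ: "(b has_sum infsum b ?J) ?J" by simp
    have le: "infsum b ?J \<le> B"
      unfolding B_def using bs \<open>b summable_on ?J\<close> b0 by (intro infsum_mono2) auto
    have g: "((\<lambda>d. (norm p / \<rho>) ^ L * b d) has_sum ((norm p / \<rho>) ^ L * infsum b ?J)) ?J"
      using bJ by (rule has_sum_cmult_right)
    have pt: "\<bar>?f d\<bar> \<le> (norm p / \<rho>) ^ L * b d" if d: "d \<in> ?J" for d
    proof -
      have L: "L \<le> fst d + snd d" using d by (auto simp: degrees_below_def)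
      have "\<bar>?f d\<bar> \<le> \<bar>c d\<bar> * norm p ^ (fst d + snd d)"
        unfolding abs_mult[of "c d"] using abs_monomial_le by (intro mult_left_mono) auto
      also have "\<dots> = b d * (norm p / \<rho>) ^ (fst d + snd d)" using rho by (simp add: b_def power_divide)
      also have "\<dots> \<le> b d * (norm p / \<rho>) ^ L"
        using rho p L b0 by (intro mult_left_mono power_decreasing) auto
      finally show ?thesis by (simp add: mult.commute)
    qed
    have "h p - taylor_poly c L p \<le> (norm p / \<rho>) ^ L * infsum b ?J"
      using f g by (rule has_sum_mono) (use pt in \<open>auto simp: abs_le_iff\<close>)
    moreover have "- 1 * (h p - taylor_poly c L p) \<le> (norm p / \<rho>) ^ L * infsum b ?J"
      using has_sum_cmult_right[OF f, of "- 1"] g by (rule has_sum_mono) (use pt in \<open>auto simp: abs_le_iff\<close>)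
    ultimately have "\<bar>h p - taylor_poly c L p\<bar> \<le> (norm p / \<rho>) ^ L * infsum b ?J"
      by (intro abs_leI) simp_all
    also have "\<dots> \<le> (norm p / \<rho>) ^ L * B" using le rho by (intro mult_left_mono) auto
    finally show ?thesis by (simp add: mult.commute)
  qed
  then show ?thesis using that rho(1) B0 by blast
qed

text \<open>The truncations follow from the scaling \<open>norm p \<sim> z powr (-1/2)\<close>.
  There \<open>z T\<close> is of order \<open>z powr (-1/2)\<close>, so dropping powers from
  \<open>2 * R\<close> on costs order \<open>z^-R\<close>; and a Taylor remainder of degree
  \<open>2 * R + 2\<close>, multiplied by \<open>z\<close>, also has order
  \<open>z^-R\<close>.\<close>

definition gaussian_approx :: "(nat \<times> nat \<Rightarrow> real) \<Rightarrow> nat \<Rightarrow> real \<Rightarrow> real \<times> real \<Rightarrow> real" where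
  "gaussian_approx c R z p =
     exp (- (z * (norm p)\<^sup>2 / 2)) * (\<Sum>m<2 * R. (z * taylor_poly c (2 * R + 2) p) ^ m / fact m)"

lemma taylor_poly_power:
  "taylor_poly c L p ^ m = (\<Sum>f\<in>{..<m} \<rightarrow>\<^sub>E degrees_below L.
     (\<Prod>i<m. c (f i)) * (fst p ^ (\<Sum>i<m. fst (f i)) * snd p ^ (\<Sum>i<m. snd (f i))))"
proof -
  have "taylor_poly c L p ^ m = (\<Prod>i<m. \<Sum>d\<in>degrees_below L. c d * (fst p ^ fst d * snd p ^ snd d))"
    by (simp add: taylor_poly_def)
  also have "\<dots> = (\<Sum>f\<in>{..<m} \<rightarrow>\<^sub>E degrees_below L. \<Prod>i<m. c (f i) * (fst p ^ fst (f i) * snd p ^ snd (f i)))"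
    by (rule prod_sum_PiE) (auto intro: finite_degrees_below)
  finally show ?thesis by (simp add: prod.distrib power_sum)
qed

lemma gaussian_approx_integral:
  assumes z: "z > 0"
  shows "has_bochner_integral lebesgue (gaussian_approx c R z)
    (2 * pi / z * (\<Sum>m<2 * R. \<Sum>f\<in>{..<m} \<rightarrow>\<^sub>E degrees_below (2 * R + 2).
      (\<Prod>i<m. c (f i)) * real (matching_number (\<Sum>i<m. fst (f i)) * matching_number (\<Sum>i<m. snd (f i))) / fact m
      * (z ^ m / z ^ (((\<Sum>i<m. fst (f i)) + (\<Sum>i<m. snd (f i))) div 2))))"
proof -
  let ?U = "\<lambda>m f. \<Sum>i<m. fst ((f :: nat \<Rightarrow> nat \<times> nat) i)" and ?W = "\<lambda>m f. \<Sum>i<m. snd ((f :: nat \<Rightarrow> nat \<times> nat) i)"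
  have eq: "gaussian_approx c R z = (\<lambda>p. \<Sum>m<2 * R. \<Sum>f\<in>{..<m} \<rightarrow>\<^sub>E degrees_below (2 * R + 2).
     (z ^ m / fact m * (\<Prod>i<m. c (f i))) * (fst p ^ ?U m f * snd p ^ ?W m f * exp (- (z * (norm p)\<^sup>2 / 2))))"
    unfolding gaussian_approx_def power_mult_distrib taylor_poly_power
    by (auto simp: fun_eq_iff sum_distrib_left sum_divide_distrib mult_ac intro!: sum.cong)
  have "has_bochner_integral lebesgue (gaussian_approx c R z) (\<Sum>m<2 * R. \<Sum>f\<in>{..<m} \<rightarrow>\<^sub>E degrees_below (2 * R + 2).
     (z ^ m / fact m * (\<Prod>i<m. c (f i))) * (2 * pi / z * (real (matching_number (?U m f) * matching_number (?W m f)) / z ^ ((?U m f + ?W m f) div 2))))"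
    unfolding eq by (intro has_bochner_integral_sum has_bochner_integral_mult_right gaussian_moment_plane z)
  also have "(\<Sum>m<2 * R. \<Sum>f\<in>{..<m} \<rightarrow>\<^sub>E degrees_below (2 * R + 2).
     (z ^ m / fact m * (\<Prod>i<m. c (f i))) * (2 * pi / z * (real (matching_number (?U m f) * matching_number (?W m f)) / z ^ ((?U m f + ?W m f) div 2))))
    = 2 * pi / z * (\<Sum>m<2 * R. \<Sum>f\<in>{..<m} \<rightarrow>\<^sub>E degrees_below (2 * R + 2).
      (\<Prod>i<m. c (f i)) * real (matching_number (?U m f) * matching_number (?W m f)) / fact m
      * (z ^ m / z ^ ((?U m f + ?W m f) div 2)))"
    unfolding sum_distrib_left by (intro sum.cong refl) (simp add: mult_ac)
  finally show ?thesis .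
qed

text \<open>\<open>exp (z h)\<close> is replaced by \<open>exp (z T)\<close>, and that by its
  truncated series. Each error carries a factor of at most
  \<open>exp (z * (norm p)\<^sup>2 / 4)\<close>, which together with the Gaussian leaves the decay
  in the claim. The exponent \<open>2 * (3 * R)\<close> is the cubic bound on \<open>T\<close>
  raised to the power \<open>2 * R\<close>.\<close>

lemma gaussian_approx_near:
  fixes p :: "real \<times> real"
  assumes z: "z \<ge> 0"
    and h: "\<bar>h\<bar> \<le> (norm p)\<^sup>2 / 4" and T: "\<bar>taylor_poly c (2 * R + 2) p\<bar> \<le> (norm p)\<^sup>2 / 4"
    and T3: "\<bar>taylor_poly c (2 * R + 2) p\<bar> \<le> B1 * norm p ^ 3"
    and hT: "\<bar>h - taylor_poly c (2 * R + 2) p\<bar> \<le> B2 * norm p ^ (2 * Suc R)"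
  shows "\<bar>exp (z * (h - (norm p)\<^sup>2 / 2)) - gaussian_approx c R z p\<bar> \<le>
    (B2 * z * norm p ^ (2 * Suc R) + B1 ^ (2 * R) * z ^ (2 * R) * norm p ^ (2 * (3 * R))) * exp (- (z * (norm p)\<^sup>2 / 4))"
proof -
  let ?T = "taylor_poly c (2 * R + 2) p"
  let ?E = "exp (- (z * (norm p)\<^sup>2 / 2))" and ?e = "exp (z * (norm p)\<^sup>2 / 4)"
  have Ee: "?E * ?e = exp (- (z * (norm p)\<^sup>2 / 4))" by (simp flip: exp_add)
  have zh: "\<bar>z * h\<bar> \<le> z * (norm p)\<^sup>2 / 4" and zT: "\<bar>z * ?T\<bar> \<le> z * (norm p)\<^sup>2 / 4"
    using mult_left_mono[OF h z] mult_left_mono[OF T z] z by (simp_all add: abs_mult)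
  have "\<bar>exp (z * h) - exp (z * ?T)\<bar> \<le> \<bar>z * h - z * ?T\<bar> * ?e"
    by (rule exp_diff_bound[OF zh zT])
  also have "\<dots> = z * \<bar>h - ?T\<bar> * ?e" using z by (simp add: abs_mult flip: right_diff_distrib)
  also have "\<dots> \<le> z * (B2 * norm p ^ (2 * Suc R)) * ?e" using z hT by (intro mult_right_mono mult_left_mono) auto
  finally have 1: "\<bar>exp (z * h) - exp (z * ?T)\<bar> \<le> B2 * z * norm p ^ (2 * Suc R) * ?e" by (simp add: mult_ac)
  have "\<bar>exp (z * ?T) - (\<Sum>m<2 * R. (z * ?T) ^ m / fact m)\<bar> \<le> \<bar>z * ?T\<bar> ^ (2 * R) * exp \<bar>z * ?T\<bar>"
    by (rule exp_Taylor_bound)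
  also have "\<dots> \<le> (z * (B1 * norm p ^ 3)) ^ (2 * R) * ?e"
    using z T3 zT by (intro mult_mono power_mono) (auto simp: abs_mult intro: mult_left_mono)
  also have "(z * (B1 * norm p ^ 3)) ^ (2 * R) = B1 ^ (2 * R) * z ^ (2 * R) * norm p ^ (2 * (3 * R))"
    by (simp add: power_mult_distrib mult_ac flip: power_mult)
  finally have 2: "\<bar>exp (z * ?T) - (\<Sum>m<2 * R. (z * ?T) ^ m / fact m)\<bar> \<le> B1 ^ (2 * R) * z ^ (2 * R) * norm p ^ (2 * (3 * R)) * ?e" .
  have "z * (h - (norm p)\<^sup>2 / 2) = - (z * (norm p)\<^sup>2 / 2) + z * h" by (simp add: algebra_simps)
  then have "exp (z * (h - (norm p)\<^sup>2 / 2)) - gaussian_approx c R z p =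
    ?E * ((exp (z * h) - exp (z * ?T)) + (exp (z * ?T) - (\<Sum>m<2 * R. (z * ?T) ^ m / fact m)))"
    unfolding gaussian_approx_def by (simp only: exp_add) (simp add: algebra_simps)
  then have "\<bar>exp (z * (h - (norm p)\<^sup>2 / 2)) - gaussian_approx c R z p\<bar> =
    ?E * \<bar>(exp (z * h) - exp (z * ?T)) + (exp (z * ?T) - (\<Sum>m<2 * R. (z * ?T) ^ m / fact m))\<bar>"
    by (simp add: abs_mult)
  also have "\<dots> \<le> ?E * (B2 * z * norm p ^ (2 * Suc R) * ?e + B1 ^ (2 * R) * z ^ (2 * R) * norm p ^ (2 * (3 * R)) * ?e)"
    by (intro mult_left_mono order_trans[OF abs_triangle_ineq] add_mono 1 2) simp
  also have "\<dots> = (B2 * z * norm p ^ (2 * Suc R) + B1 ^ (2 * R) * z ^ (2 * R) * norm p ^ (2 * (3 * R))) * (?E * ?e)"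
    by (simp only: algebra_simps)
  finally show ?thesis unfolding Ee .
qed

text \<open>Away from the origin smallness comes from the freedom in \<open>N\<close>: where
  \<open>q = norm p / r \<ge> 1\<close>, powers of \<open>q\<close> may be raised at will, and
  integrating \<open>norm p ^ (2 * N)\<close> against the Gaussian gains powers of
  \<open>1 / z\<close> that beat the crude factor \<open>z ^ (2 * R)\<close>.\<close>

lemma gaussian_approx_far:
  assumes r: "r > 0" and N: "2 * R * (2 * R + 2) \<le> 2 * N"
  obtains C where "C \<ge> 0" "\<And>z p. z \<ge> 1 \<Longrightarrow> norm p \<ge> r \<Longrightarrow>
    \<bar>gaussian_approx c R z p\<bar> \<le> C * z ^ (2 * R) * norm p ^ (2 * N) * exp (- (z * (norm p)\<^sup>2 / 4))"
proof -
  let ?L = "2 * R + 2"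
  define A where "A = (\<Sum>d\<in>degrees_below ?L. \<bar>c d\<bar> * r ^ (fst d + snd d))"
  have A0: "A \<ge> 0" unfolding A_def using r by (intro sum_nonneg) auto
  define C where "C = (\<Sum>m<2 * R. A ^ m) / r ^ (2 * N)"
  have C0: "C \<ge> 0" unfolding C_def using A0 r by (intro divide_nonneg_nonneg sum_nonneg) auto
  have main: "\<bar>gaussian_approx c R z p\<bar> \<le> C * z ^ (2 * R) * norm p ^ (2 * N) * exp (- (z * (norm p)\<^sup>2 / 4))"
    if z: "z \<ge> 1" and p: "norm p \<ge> r" for z p
  proof -
    define q where "q = norm p / r"
    have q: "q \<ge> 1" "norm p = r * q" using p r by (auto simp: q_def)
    have T: "\<bar>taylor_poly c ?L p\<bar> \<le> A * q ^ ?L"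
    proof -
      have "\<bar>taylor_poly c ?L p\<bar> \<le> (\<Sum>d\<in>degrees_below ?L. \<bar>c d * (fst p ^ fst d * snd p ^ snd d)\<bar>)"
        unfolding taylor_poly_def by (rule sum_abs)
      also have "\<dots> \<le> (\<Sum>d\<in>degrees_below ?L. \<bar>c d\<bar> * r ^ (fst d + snd d) * q ^ ?L)"
      proof (rule sum_mono)
        fix d assume d: "d \<in> degrees_below ?L"
        have "\<bar>c d * (fst p ^ fst d * snd p ^ snd d)\<bar> \<le> \<bar>c d\<bar> * norm p ^ (fst d + snd d)"
          unfolding abs_mult[of "c d"] using abs_monomial_le by (intro mult_left_mono) auto
        also have "\<dots> = \<bar>c d\<bar> * r ^ (fst d + snd d) * q ^ (fst d + snd d)"
          by (simp add: q(2) power_mult_distrib)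
        also have "\<dots> \<le> \<bar>c d\<bar> * r ^ (fst d + snd d) * q ^ ?L"
          using d q r by (intro mult_left_mono power_increasing) (auto simp: degrees_below_def)
        finally show "\<bar>c d * (fst p ^ fst d * snd p ^ snd d)\<bar> \<le> \<bar>c d\<bar> * r ^ (fst d + snd d) * q ^ ?L" .
      qed
      finally show ?thesis by (simp add: A_def sum_distrib_right)
    qed
    have term_le: "\<bar>(z * taylor_poly c ?L p) ^ m / fact m\<bar> \<le> A ^ m * (z ^ (2 * R) * q ^ (2 * N))" if m: "m < 2 * R" for m
    proof -
      have "\<bar>(z * taylor_poly c ?L p) ^ m / fact m\<bar> = (z * \<bar>taylor_poly c ?L p\<bar>) ^ m / fact m"
        using z by (simp add: abs_mult power_abs)
      also have "\<dots> \<le> (z * \<bar>taylor_poly c ?L p\<bar>) ^ m / 1"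
        using z by (intro divide_left_mono) (auto simp: fact_ge_1)
      also have "\<dots> = (z * \<bar>taylor_poly c ?L p\<bar>) ^ m" by simp
      also have "\<dots> \<le> (z * (A * q ^ ?L)) ^ m" using T z by (intro power_mono mult_left_mono) auto
      also have "\<dots> = A ^ m * (z ^ m * q ^ (?L * m))"
        unfolding power_mult_distrib power_mult by (rule mult.left_commute)
      also have "\<dots> \<le> A ^ m * (z ^ (2 * R) * q ^ (2 * N))"
      proof (rule mult_left_mono)
        have "?L * m \<le> ?L * (2 * R)" using m by (intro mult_left_mono) auto
        also have "\<dots> \<le> 2 * N" using N by (simp only: mult.commute)
        finally have "q ^ (?L * m) \<le> q ^ (2 * N)" using q by (intro power_increasing) auto
        moreover have "z ^ m \<le> z ^ (2 * R)" using z m by (intro power_increasing) auto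
        ultimately show "z ^ m * q ^ (?L * m) \<le> z ^ (2 * R) * q ^ (2 * N)"
          using z q by (intro mult_mono) auto
      qed (use A0 in auto)
      finally show ?thesis .
    qed
    have "\<bar>gaussian_approx c R z p\<bar> = exp (- (z * (norm p)\<^sup>2 / 2)) * \<bar>\<Sum>m<2 * R. (z * taylor_poly c ?L p) ^ m / fact m\<bar>"
      unfolding gaussian_approx_def by (simp add: abs_mult)
    also have "\<dots> \<le> exp (- (z * (norm p)\<^sup>2 / 4)) * (\<Sum>m<2 * R. A ^ m * (z ^ (2 * R) * q ^ (2 * N)))"
    proof (rule mult_mono)
      have "z * (norm p)\<^sup>2 / 4 \<le> z * (norm p)\<^sup>2 / 2" using z by (intro divide_left_mono) auto
      then show "exp (- (z * (norm p)\<^sup>2 / 2)) \<le> exp (- (z * (norm p)\<^sup>2 / 4))" by simp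
      show "\<bar>\<Sum>m<2 * R. (z * taylor_poly c ?L p) ^ m / fact m\<bar> \<le> (\<Sum>m<2 * R. A ^ m * (z ^ (2 * R) * q ^ (2 * N)))"
        by (rule order_trans[OF sum_abs]) (intro sum_mono term_le, simp)
    qed auto
    also have "\<dots> = C * z ^ (2 * R) * norm p ^ (2 * N) * exp (- (z * (norm p)\<^sup>2 / 4))"
      unfolding sum_distrib_right[symmetric] using r by (simp add: C_def q_def power_divide mult_ac)
    finally show ?thesis .
  qed
  show ?thesis by (rule that[OF C0 main])
qed

text \<open>Monomials of degree at least 3 vanish at the origin, so the expansion itself forces
  \<open>g 0 = 0\<close>.\<close>

lemma has_sum_at_origin:
  assumes "((\<lambda>d. c d * (0 ^ fst d * 0 ^ snd d)) has_sum (a :: real)) {d :: nat \<times> nat. 3 \<le> fst d + snd d}"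
  shows "a = 0"
proof -
  have "c d * (0 ^ fst d * 0 ^ snd d) = 0" if "d \<in> {d. 3 \<le> fst d + snd d}" for d
    using that by (cases "fst d"; cases "snd d") auto
  then have "((\<lambda>d. c d * (0 ^ fst d * 0 ^ snd d)) has_sum 0) {d. 3 \<le> fst d + snd d}"
    by (rule has_sum_0)
  then show ?thesis using assms has_sum_unique by blast
qed

lemma taylor_bounds:
  assumes ev: "\<forall>\<^sub>F p in nhds (0 :: real \<times> real).
    ((\<lambda>d. c d * (fst p ^ fst d * snd p ^ snd d)) has_sum (h p :: real)) {d. 3 \<le> fst d + snd d}"
  obtains r B1 B2 where "r > 0" "B1 \<ge> 0" "B2 \<ge> 0"
    "\<forall>p. norm p \<le> r \<longrightarrow> \<bar>h p\<bar> \<le> (norm p)\<^sup>2 / 4 \<and> \<bar>taylor_poly c L p\<bar> \<le> (norm p)\<^sup>2 / 4 \<and>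
       \<bar>taylor_poly c L p\<bar> \<le> B1 * norm p ^ 3 \<and> \<bar>h p - taylor_poly c L p\<bar> \<le> B2 * norm p ^ L"
proof -
  obtain \<rho> B where rho: "\<rho> > 0" and B: "B \<ge> 0"
    and rem: "\<And>p L. norm p \<le> \<rho> \<Longrightarrow> \<bar>h p - taylor_poly c L p\<bar> \<le> B * (norm p / \<rho>) ^ L"
    by (rule taylor_remainder[OF ev]) blast
  \<comment> \<open>The factor 2 comes from bounding \<open>T\<close> by \<open>h\<close> and
    \<open>h - T\<close>, both of which are at most \<open>B * (norm p / \<rho>) ^ 3\<close> when
    \<open>L\<close> exceeds 3.\<close>
  define B1 where "B1 = 2 * B / \<rho> ^ 3"
  \<comment> \<open>On this radius \<open>B1 * norm p \<le> 1 / 4\<close>, so the cubic bounds turn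
    into \<open>(norm p)\<^sup>2 / 4\<close>. The summand 1 prevents a division by zero.\<close>
  define r where "r = min \<rho> (1 / (4 * (B1 + 1)))"
  have B1: "B1 \<ge> 0" using B rho by (simp add: B1_def)
  have r: "r > 0" "r \<le> \<rho>" "B1 * r \<le> 1 / 4"
  proof -
    show "r > 0" "r \<le> \<rho>" using rho B1 by (simp_all add: r_def)
    have "B1 * r \<le> B1 * (1 / (4 * (B1 + 1)))" using B1 by (intro mult_left_mono) (auto simp: r_def)
    also have "\<dots> \<le> 1 / 4" using B1 by (simp add: field_simps)
    finally show "B1 * r \<le> 1 / 4" .
  qed
  \<comment> \<open>With \<open>L = 3\<close> the Taylor polynomial is empty, so the remainder
    estimate bounds \<open>h\<close> itself.\<close>
  have d3: "degrees_below 3 = {}" "L \<le> 3 \<Longrightarrow> degrees_below L = {}" by (auto simp: degrees_below_def)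
  have h3: "\<bar>h p\<bar> \<le> B * (norm p / \<rho>) ^ 3" if "norm p \<le> \<rho>" for p
    using rem[OF that, of 3] by (simp add: taylor_poly_def d3)
  have B13: "2 * (B * (norm p / \<rho>) ^ 3) = B1 * norm p ^ 3" for p :: "real \<times> real"
    by (simp add: B1_def power_divide)
  have h3': "\<bar>h p\<bar> \<le> B1 * norm p ^ 3" if "norm p \<le> \<rho>" for p
    unfolding B13[symmetric] using h3[OF that] B rho by (smt (verit) abs_ge_zero)
  have T3: "\<bar>taylor_poly c L p\<bar> \<le> B1 * norm p ^ 3" if p: "norm p \<le> \<rho>" for p
  proof (cases "L \<le> 3")
    case True
    then show ?thesis using B1 by (simp add: taylor_poly_def d3)
  next
    case False
    have "B * (norm p / \<rho>) ^ L \<le> B * (norm p / \<rho>) ^ 3"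
      using False p rho B by (intro mult_left_mono power_decreasing) auto
    then have "\<bar>taylor_poly c L p\<bar> \<le> 2 * (B * (norm p / \<rho>) ^ 3)"
      using rem[OF p, of L] h3[OF p] by linarith
    then show ?thesis unfolding B13 .
  qed
  have sq: "B1 * norm p ^ 3 \<le> (norm p)\<^sup>2 / 4" if "norm p \<le> r" for p :: "real \<times> real"
  proof -
    have "B1 * norm p ^ 3 = (B1 * norm p) * (norm p)\<^sup>2" by (simp add: power3_eq_cube power2_eq_square)
    also have "\<dots> \<le> (B1 * r) * (norm p)\<^sup>2" using that B1 by (intro mult_right_mono mult_left_mono) auto
    also have "\<dots> \<le> 1 / 4 * (norm p)\<^sup>2" using r by (intro mult_right_mono) auto
    finally show ?thesis by simp
  qed
  show ?thesis
  proof (rule that)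
    show "r > 0" by (rule r(1))
    show "B1 \<ge> 0" by (rule B1)
    show "B / \<rho> ^ L \<ge> 0" using B rho by simp
    show "\<forall>p. norm p \<le> r \<longrightarrow> \<bar>h p\<bar> \<le> (norm p)\<^sup>2 / 4 \<and> \<bar>taylor_poly c L p\<bar> \<le> (norm p)\<^sup>2 / 4 \<and>
       \<bar>taylor_poly c L p\<bar> \<le> B1 * norm p ^ 3 \<and> \<bar>h p - taylor_poly c L p\<bar> \<le> B / \<rho> ^ L * norm p ^ L"
    proof (intro allI impI conjI)
      fix p :: "real \<times> real" assume p: "norm p \<le> r"
      then have p': "norm p \<le> \<rho>" using r(2) by simp
      show "\<bar>h p\<bar> \<le> (norm p)\<^sup>2 / 4" using h3'[OF p'] sq[OF p] by linarith
      show "\<bar>taylor_poly c L p\<bar> \<le> (norm p)\<^sup>2 / 4" using T3[OF p'] sq[OF p] by linarith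
      show "\<bar>taylor_poly c L p\<bar> \<le> B1 * norm p ^ 3" by (rule T3[OF p'])
      show "\<bar>h p - taylor_poly c L p\<bar> \<le> B / \<rho> ^ L * norm p ^ L"
        using rem[OF p', of L] by (simp add: power_divide)
    qed
  qed
qed

lemma laplace_remainder:
  assumes int: "\<And>z. z > 0 \<Longrightarrow> set_integrable lebesgue D (\<lambda>p. exp (z * g p))"
    and nbhd: "0 \<in> interior D"
    and sup: "attains_unique_supremum_at g D 0"
    and ev: "\<forall>\<^sub>F p in nhds (0 :: real \<times> real).
      ((\<lambda>d. c d * (fst p ^ fst d * snd p ^ snd d)) has_sum (g p + (norm p)\<^sup>2 / 2)) {d. 3 \<le> fst d + snd d}"
  obtains K where "\<And>z. z \<ge> 1 \<Longrightarrow>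
    \<bar>laplace_integral D g z - z / (2 * pi) * (LINT p|lebesgue. gaussian_approx c R z p)\<bar> \<le> K / z ^ R"
proof -
  define h where "h = (\<lambda>p. g p + (norm p)\<^sup>2 / 2)"
  have ev': "\<forall>\<^sub>F p in nhds (0 :: real \<times> real).
      ((\<lambda>d. c d * (fst p ^ fst d * snd p ^ snd d)) has_sum h p) {d. 3 \<le> fst d + snd d}"
    using ev by (simp only: h_def)
  have "((\<lambda>d. c d * (0 ^ fst d * 0 ^ snd d)) has_sum g 0) {d. 3 \<le> fst d + snd d}"
    using eventually_nhds_x_imp_x[OF ev] by simp
  then have g0: "g 0 = 0" by (rule has_sum_at_origin)
  obtain r' B1 B2 where r': "r' > 0" and B12: "B1 \<ge> 0" "B2 \<ge> 0" and bd:
    "\<forall>p. norm p \<le> r' \<longrightarrow> \<bar>h p\<bar> \<le> (norm p)\<^sup>2 / 4 \<and> \<bar>taylor_poly c (2 * R + 2) p\<bar> \<le> (norm p)\<^sup>2 / 4 \<and>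
       \<bar>taylor_poly c (2 * R + 2) p\<bar> \<le> B1 * norm p ^ 3 \<and> \<bar>h p - taylor_poly c (2 * R + 2) p\<bar> \<le> B2 * norm p ^ (2 * R + 2)"
    using taylor_bounds[OF ev', of "2 * R + 2" thesis] that by blast
  obtain r'' where r'': "r'' > 0" "ball 0 r'' \<subseteq> D" using nbhd unfolding mem_interior by blast
  define r where "r = min r' r''"
  have r: "r > 0" using r' r'' by (simp add: r_def)
  have "\<exists>c<g 0. \<forall>p\<in>D - ball 0 r. g p \<le> c"
    using sup r unfolding attains_unique_supremum_at_def by auto
  then obtain c0 where c0: "c0 < g 0" "\<forall>p\<in>D - ball 0 r. g p \<le> c0" by blast
  define \<delta> where "\<delta> = - c0"
  have d: "\<delta> > 0" "p \<in> D \<Longrightarrow> norm p \<ge> r \<Longrightarrow> g p \<le> - \<delta>" for p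
    using c0 g0 by (simp_all add: \<delta>_def)
  \<comment> \<open>The first summand meets the requirement of \<open>gaussian_approx_far\<close>;
    the second gives \<open>z ^ (2 * R) / z ^ N \<le> 1 / z ^ R\<close>.\<close>
  define N where "N = 2 * R * Suc R + 3 * R"
  have N: "2 * R * (2 * R + 2) \<le> 2 * N" by (simp add: N_def)
  obtain C where C: "C \<ge> 0" "\<And>z p. z \<ge> 1 \<Longrightarrow> norm p \<ge> r \<Longrightarrow>
    \<bar>gaussian_approx c R z p\<bar> \<le> C * z ^ (2 * R) * norm p ^ (2 * N) * exp (- (z * (norm p)\<^sup>2 / 4))"
    using gaussian_approx_far[OF r N] by blast
  define F where "F = (\<lambda>z p. indicator D p * exp (z * g p))"
  have Fint: "integrable lebesgue (F z)" if "z > 0" for z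
    using int[OF that] by (simp add: F_def set_integrable_def)
  have L: "laplace_integral D g z = z / (2 * pi) * (LINT p|lebesgue. F z p)" for z
    by (simp add: laplace_integral_def set_lebesgue_integral_def F_def)
  define G where "G = (\<lambda>k z (p :: real \<times> real). norm p ^ (2 * k) * exp (- (z * (norm p)\<^sup>2 / 4)))"
  \<comment> \<open>One dominating function for the whole plane: the two errors near the origin, the
    Gaussian part far away, and the original integrand far away. All summands are nonnegative, so no
    case distinction is needed when integrating.\<close>
  define b where "b = (\<lambda>z p. B2 * z * G (Suc R) z p + B1 ^ (2 * R) * z ^ (2 * R) * G (3 * R) z p
     + C * z ^ (2 * R) * G N z p + exp (- (z - 1) * \<delta>) * F 1 p)"
  have G0: "G k z p \<ge> 0" for k z p by (simp add: G_def)
  have F0: "F z p \<ge> 0" for z p by (simp add: F_def)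
  have pt: "\<bar>F z p - gaussian_approx c R z p\<bar> \<le> b z p" if z: "z \<ge> 1" for z p
  proof (cases "norm p < r")
    case True
    then have p: "p \<in> D" "norm p \<le> r'" using r'' by (auto simp: r_def)
    have "F z p = exp (z * (h p - (norm p)\<^sup>2 / 2))" using p by (simp add: F_def h_def)
    then have "\<bar>F z p - gaussian_approx c R z p\<bar> \<le> B2 * z * G (Suc R) z p + B1 ^ (2 * R) * z ^ (2 * R) * G (3 * R) z p"
      using gaussian_approx_near[of z "h p" p c R B1 B2] bd[rule_format, OF p(2)] z
      by (simp add: G_def distrib_right mult.assoc)
    moreover have "C * z ^ (2 * R) * G N z p \<ge> 0" "exp (- (z - 1) * \<delta>) * F 1 p \<ge> 0"
      using C z G0 F0 by simp_all
    ultimately show ?thesis unfolding b_def by linarith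
  next
    case False
    then have p: "norm p \<ge> r" by simp
    have "F z p \<le> exp (- (z - 1) * \<delta>) * F 1 p"
    proof (cases "p \<in> D")
      case True
      \<comment> \<open>Only \<open>z - 1\<close> copies of \<open>g\<close> are estimated by the
        gap; the remaining \<open>exp (g p)\<close> is integrable by the hypothesis at
        \<open>z = 1\<close>.\<close>
      have "(z - 1) * g p \<le> (z - 1) * - \<delta>" using d(2)[OF True p] z by (intro mult_left_mono) auto
      then have "z * g p \<le> - (z - 1) * \<delta> + 1 * g p" by (simp add: algebra_simps)
      then have "exp (z * g p) \<le> exp (- (z - 1) * \<delta> + 1 * g p)" by (rule exp_le_cancel_iff[THEN iffD2])
      then show ?thesis using True unfolding F_def exp_add by simp
    qed (simp add: F_def)
    moreover have "\<bar>gaussian_approx c R z p\<bar> \<le> C * z ^ (2 * R) * G N z p"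
      using C(2)[OF z p] by (simp add: G_def mult.assoc)
    moreover have "B2 * z * G (Suc R) z p \<ge> 0" "B1 ^ (2 * R) * z ^ (2 * R) * G (3 * R) z p \<ge> 0"
      using B12 z G0 by simp_all
    ultimately show ?thesis using F0[of z p] unfolding b_def by linarith
  qed
  have "\<exists>Ck. Ck \<ge> 0 \<and> (\<forall>z>0. has_bochner_integral lebesgue (G k z) (Ck / z ^ Suc k))" for k
    by (rule gaussian_radial_moment[of k]) (auto simp: G_def)
  then obtain M where M: "\<And>k. M k \<ge> 0" "\<And>k z. z > 0 \<Longrightarrow> has_bochner_integral lebesgue (G k z) (M k / z ^ Suc k)"
    by metis
  define J where "J = (LINT p|lebesgue. F 1 p)"
  have J0: "J \<ge> 0" unfolding J_def using F0 by (intro integral_nonneg_AE) auto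
  have bint: "has_bochner_integral lebesgue (b z) (B2 * z * (M (Suc R) / z ^ Suc (Suc R))
     + B1 ^ (2 * R) * z ^ (2 * R) * (M (3 * R) / z ^ Suc (3 * R)) + C * z ^ (2 * R) * (M N / z ^ Suc N)
     + exp (- (z - 1) * \<delta>) * J)" if z: "z > 0" for z
    unfolding b_def
    by (intro has_bochner_integral_add has_bochner_integral_mult_right M(2)[OF z])
      (simp add: J_def has_bochner_integral_integrable Fint)
  define K where "K = B2 * M (Suc R) + B1 ^ (2 * R) * M (3 * R) + C * M N + fact (Suc R) / \<delta> ^ Suc R * exp \<delta> * J"
  have "\<bar>laplace_integral D g z - z / (2 * pi) * (LINT p|lebesgue. gaussian_approx c R z p)\<bar> \<le> K / z ^ R"
    if z: "z \<ge> 1" for z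
  proof -
    have z0: "z > 0" using z by simp
    have Qint: "integrable lebesgue (gaussian_approx c R z)"
      using gaussian_approx_integral[OF z0] by (simp add: has_bochner_integral_iff)
    let ?b = "LINT p|lebesgue. b z p"
    have le: "\<bar>LINT p|lebesgue. F z p - gaussian_approx c R z p\<bar> \<le> ?b"
      using Fint[OF z0] Qint bint[OF z0] pt[OF z]
      by (intro integral_abs_bound_integral) (auto simp: has_bochner_integral_iff)
    have "\<bar>laplace_integral D g z - z / (2 * pi) * (LINT p|lebesgue. gaussian_approx c R z p)\<bar>
        = z / (2 * pi) * \<bar>LINT p|lebesgue. F z p - gaussian_approx c R z p\<bar>"
    proof -
      have "laplace_integral D g z - z / (2 * pi) * (LINT p|lebesgue. gaussian_approx c R z p)
          = z / (2 * pi) * (LINT p|lebesgue. F z p - gaussian_approx c R z p)"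
        unfolding L Bochner_Integration.integral_diff[OF Fint[OF z0] Qint] by (rule right_diff_distrib[symmetric])
      then show ?thesis using z0 by (simp add: abs_mult)
    qed
    also have "\<dots> \<le> z * ?b"
    proof -
      have "z / (2 * pi) \<le> z / 1" using z pi_gt3 by (intro divide_left_mono) auto
      then show ?thesis using le z0 by (intro mult_mono) auto
    qed
    \<comment> \<open>The prefactor \<open>z\<close> absorbs the extra \<open>1 / z\<close> of each
      Gaussian moment. In the last summand it is kept, which is why \<open>power_exp_decay\<close>
      is used with exponent \<open>Suc R\<close>.\<close>
    also have "\<dots> = B2 * M (Suc R) / z ^ R + B1 ^ (2 * R) * M (3 * R) / z ^ R + C * M N * (z ^ (2 * R) / z ^ N)
        + z ^ Suc R * exp (- (z - 1) * \<delta>) * J / z ^ R"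
    proof -
      have "z ^ (3 * R) = z ^ (2 * R) * z ^ R" by (simp flip: power_add)
      then show ?thesis
        using bint[OF z0] z0 by (simp add: has_bochner_integral_iff algebra_simps)
    qed
    also have "\<dots> \<le> B2 * M (Suc R) / z ^ R + B1 ^ (2 * R) * M (3 * R) / z ^ R + C * M N * (1 / z ^ R)
        + fact (Suc R) / \<delta> ^ Suc R * exp \<delta> * J / z ^ R"
    proof (intro add_mono order_refl mult_left_mono divide_right_mono mult_right_mono)
      have "z ^ (2 * R) * z ^ R \<le> z ^ N"
        using z by (simp add: N_def flip: power_add) (intro power_increasing, auto)
      then show "z ^ (2 * R) / z ^ N \<le> 1 / z ^ R" using z0 by (simp add: field_simps)
      show "z ^ Suc R * exp (- (z - 1) * \<delta>) \<le> fact (Suc R) / \<delta> ^ Suc R * exp \<delta>"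
        using d z0 by (intro power_exp_decay) auto
    qed (use C M J0 z0 in auto)
    also have "\<dots> = K / z ^ R" by (simp add: K_def add_divide_distrib)
    finally show ?thesis .
  qed
  then show ?thesis by (rule that)
qed

section \<open>Comparison of the coefficients\<close>

definition family_term :: "(nat \<times> nat \<Rightarrow> real) \<Rightarrow> nat \<Rightarrow> (nat \<Rightarrow> nat \<times> nat) \<Rightarrow> real" where
  "family_term c m f = (\<Prod>i<m. c (f i)) *
     real (matching_number (\<Sum>i<m. fst (f i)) * matching_number (\<Sum>i<m. snd (f i))) / fact m"

text \<open>Minus the Euler characteristic. If all degrees are at least 3, the subtraction is not
  truncated; if the total degree is odd, \<open>div\<close> rounds, but then
  \<open>family_term\<close> is 0.\<close>

definition family_order :: "nat \<Rightarrow> (nat \<Rightarrow> nat \<times> nat) \<Rightarrow> nat" where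
  "family_order m f = ((\<Sum>i<m. fst (f i)) + (\<Sum>i<m. snd (f i))) div 2 - m"

definition families :: "nat \<Rightarrow> (nat \<times> (nat \<Rightarrow> nat \<times> nat)) set" where
  "families R = (SIGMA m:{..<2 * R}. {..<m} \<rightarrow>\<^sub>E degrees_below (2 * R + 2))"

lemma finite_families: "finite (families R)"
  unfolding families_def by (intro finite_SigmaI finite_PiE finite_degrees_below) auto

lemma degree_sum_ge:
  fixes f :: "nat \<Rightarrow> nat \<times> nat"
  assumes "\<And>i. i < m \<Longrightarrow> 3 \<le> fst (f i) + snd (f i)"
  shows "3 * m \<le> (\<Sum>i<m. fst (f i)) + (\<Sum>i<m. snd (f i))"
  using sum_bounded_below[of "{..<m}" 3 "\<lambda>i. fst (f i) + snd (f i)"] assms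
  by (simp add: sum.distrib mult.commute)

text \<open>The other \<open>m - 1\<close> members use up at least 3 each. This bounds a single
  vertex degree in terms of the order, so that it stays below the Taylor truncation.\<close>

lemma degree_le:
  fixes f :: "nat \<Rightarrow> nat \<times> nat"
  assumes "\<And>i. i < m \<Longrightarrow> 3 \<le> fst (f i) + snd (f i)" "j < m"
  shows "fst (f j) + snd (f j) + 3 * (m - 1) \<le> (\<Sum>i<m. fst (f i)) + (\<Sum>i<m. snd (f i))"
proof -
  have "(\<Sum>i\<in>{..<m} - {j}. fst (f i) + snd (f i)) \<ge> (\<Sum>i\<in>{..<m} - {j}. 3)"
    using assms by (intro sum_mono) auto
  moreover have "(\<Sum>i<m. fst (f i) + snd (f i)) = (fst (f j) + snd (f j)) + (\<Sum>i\<in>{..<m} - {j}. fst (f i) + snd (f i))"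
    using assms(2) by (intro sum.remove) auto
  ultimately show ?thesis using assms(2) by (simp add: sum.distrib mult.commute)
qed

text \<open>Truncation is invisible in orders below \<open>R\<close>: such families have
  \<open>m \<le> 2 * n < 2 * R\<close> members, of degree at most
  \<open>2 * n + 2 < 2 * R + 2\<close>. On the graph side only families with a degree below 3 are
  discarded, on the integral side only those of odd total degree, and both kinds contribute
  0.\<close>

lemma graph_coeff_eq_sum_families:
  assumes n: "n < R"
  shows "graph_coeff \<Lambda> n =
    (\<Sum>(m, f)\<in>{(m, f) \<in> families R. family_order m f = n}.
       family_term (\<lambda>d. \<Lambda> d / (fact (fst d) * fact (snd d))) m f)"
proof -
  let ?c = "\<lambda>d. \<Lambda> d / (fact (fst d) * fact (snd d))"
  let ?U = "\<lambda>m f. \<Sum>i<m. fst ((f :: nat \<Rightarrow> nat \<times> nat) i)" and ?W = "\<lambda>m f. \<Sum>i<m. snd ((f :: nat \<Rightarrow> nat \<times> nat) i)"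
  define a where "a = (\<lambda>k f. case k of (m, U, W) \<Rightarrow> real (matching_number U * matching_number W) / fact m *
     (\<Prod>i<m. (if 3 \<le> fst (f i) + snd (f i) then \<Lambda> (f i) else 0) / (fact (fst (f i)) * fact (snd (f i)))))"
  define X where "X = (SIGMA k:graph_classes_sizes n. case k of (m, U, W) \<Rightarrow> degree_families m U W)"
  define X' where "X' = {(k, f) \<in> X. \<forall>i<fst k. 3 \<le> fst (f i) + snd (f i)}"
  \<comment> \<open>Evenness makes \<open>family_order m f = n\<close> equivalent to a total degree
    of exactly \<open>2 * (n + m)\<close>, so that \<open>U\<close> and \<open>W\<close> can be
    recovered from \<open>f\<close>.\<close>
  define Y where "Y = {(m, f) \<in> families R. family_order m f = n \<and> even (?U m f + ?W m f)}"
  have fX: "finite X" unfolding X_def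
    by (intro finite_SigmaI finite_graph_classes_sizes) (auto intro: finite_degree_families)
  have "graph_coeff \<Lambda> n = (\<Sum>k\<in>graph_classes_sizes n. \<Sum>f\<in>(case k of (m, U, W) \<Rightarrow> degree_families m U W). a k f)"
    unfolding graph_coeff_eq a_def by (intro sum.cong refl) (auto simp: sum_distrib_left)
  also have "\<dots> = (\<Sum>(k, f)\<in>X. a k f)"
    unfolding X_def by (intro sum.Sigma finite_graph_classes_sizes) (auto intro: finite_degree_families)
  also have "\<dots> = (\<Sum>(k, f)\<in>X'. a k f)"
  proof (rule sum.mono_neutral_right[OF fX])
    show "X' \<subseteq> X" by (auto simp: X'_def)
    show "\<forall>p\<in>X - X'. (case p of (k, f) \<Rightarrow> a k f) = 0"
    proof
      fix p assume p: "p \<in> X - X'"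
      obtain m U W f where pf: "p = ((m, U, W), f)" by (cases p) auto
      then obtain i where "i < m" "\<not> 3 \<le> fst (f i) + snd (f i)" using p by (auto simp: X'_def)
      then have "(\<Prod>i<m. (if 3 \<le> fst (f i) + snd (f i) then \<Lambda> (f i) else 0) / (fact (fst (f i)) * fact (snd (f i)))) = 0"
        by (intro prod_zero) auto
      then show "(case p of (k, f) \<Rightarrow> a k f) = 0" unfolding pf a_def prod.case by (simp only: mult_zero_right)
    qed
  qed
  also have "\<dots> = (\<Sum>(m, f)\<in>Y. family_term ?c m f)"
  proof (rule sum.reindex_bij_witness[where j = "\<lambda>(k, f). (fst k, f)" and i = "\<lambda>(m, f). ((m, ?U m f, ?W m f), f)"])
    fix p assume "p \<in> X'"
    then obtain m U W f where pf: "p = ((m, U, W), f)" and m: "m \<le> 2 * n" and UW: "U + W = 2 * (n + m)"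
      and f: "f \<in> {..<m} \<rightarrow>\<^sub>E UNIV" and s: "?U m f = U" "?W m f = W"
      and d3: "\<And>i. i < m \<Longrightarrow> 3 \<le> fst (f i) + snd (f i)"
      by (auto simp: X'_def X_def graph_classes_sizes_def degree_families_def)
    show "(case (case p of (k, f) \<Rightarrow> (fst k, f)) of (m, f) \<Rightarrow> ((m, ?U m f, ?W m f), f)) = p"
      by (simp add: pf s)
    have "f j \<in> degrees_below (2 * R + 2)" if "j < m" for j
      using degree_le[of m f j] d3 that m n UW s by (auto simp: degrees_below_def)
    then have "f \<in> {..<m} \<rightarrow>\<^sub>E degrees_below (2 * R + 2)" using f by (auto simp: PiE_iff)
    moreover have "even (U + W)" unfolding UW by simp
    then have "even U = even W" by (simp only: even_add)
    ultimately show "(case p of (k, f) \<Rightarrow> (fst k, f)) \<in> Y"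
      using m n UW by (simp add: pf Y_def families_def family_order_def s)
    have "(\<Prod>i<m. (if 3 \<le> fst (f i) + snd (f i) then \<Lambda> (f i) else 0) / (fact (fst (f i)) * fact (snd (f i)))) = (\<Prod>i<m. ?c (f i))"
      using d3 by (intro prod.cong) auto
    then show "(case (case p of (k, f) \<Rightarrow> (fst k, f)) of (m, f) \<Rightarrow> family_term ?c m f) = (case p of (k, f) \<Rightarrow> a k f)"
      by (simp add: pf a_def family_term_def s)
  next
    fix p assume "p \<in> Y"
    then obtain m f where pf: "p = (m, f)" and f: "f \<in> {..<m} \<rightarrow>\<^sub>E degrees_below (2 * R + 2)"
      and o: "family_order m f = n" and e: "even (?U m f + ?W m f)"
      by (auto simp: Y_def families_def)
    show "(case (case p of (m, f) \<Rightarrow> ((m, ?U m f, ?W m f), f)) of (k, f) \<Rightarrow> (fst k, f)) = p" by (simp add: pf)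
    have d3: "3 \<le> fst (f i) + snd (f i)" if "i < m" for i using f that by (auto simp: degrees_below_def)
    have ge: "3 * m \<le> ?U m f + ?W m f" by (rule degree_sum_ge) (rule d3)
    obtain q where q: "?U m f + ?W m f = 2 * q" using e by (rule evenE)
    have "?U m f + ?W m f = 2 * (n + m)" "m \<le> 2 * n" using o q ge unfolding family_order_def q by auto
    then show "(case p of (m, f) \<Rightarrow> ((m, ?U m f, ?W m f), f)) \<in> X'"
      using f d3 by (auto simp: pf X'_def X_def graph_classes_sizes_def degree_families_def PiE_iff)
  qed
  also have "\<dots> = (\<Sum>(m, f)\<in>{(m, f) \<in> families R. family_order m f = n}. family_term ?c m f)"
  proof (rule sum.mono_neutral_left)
    show "finite {(m, f) \<in> families R. family_order m f = n}"
      by (rule finite_subset[OF _ finite_families[of R]]) auto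
    show "Y \<subseteq> {(m, f) \<in> families R. family_order m f = n}" by (auto simp: Y_def)
    show "\<forall>p\<in>{(m, f) \<in> families R. family_order m f = n} - Y. (case p of (m, f) \<Rightarrow> family_term ?c m f) = 0"
    proof
      fix p assume "p \<in> {(m, f) \<in> families R. family_order m f = n} - Y"
      then obtain m f where pf: "p = (m, f)" "odd (?U m f + ?W m f)" by (auto simp: Y_def)
      then have "odd (?U m f) \<or> odd (?W m f)" by auto
      then have "matching_number (?U m f) * matching_number (?W m f) = 0"
        using matching_number_odd by fastforce
      then show "(case p of (m, f) \<Rightarrow> family_term ?c m f) = 0"
        unfolding pf prod.case family_term_def by (simp only: of_nat_0 mult_zero_right div_0)
    qed
  qed
  finally show ?thesis .
qed

text \<open>The integral is a finite sum of powers of \<open>1 / z\<close>. Orders below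
  \<open>R\<close> reproduce the graph coefficients exactly, and each of the finitely many other
  terms is at most its coefficient times \<open>1 / z ^ R\<close> for
  \<open>z \<ge> 1\<close>.\<close>

lemma gaussian_approx_expansion:
  fixes \<Lambda> :: "nat \<times> nat \<Rightarrow> real"
  obtains K where "\<And>z. z \<ge> 1 \<Longrightarrow>
    \<bar>z / (2 * pi) * (LINT p|lebesgue. gaussian_approx (\<lambda>d. \<Lambda> d / (fact (fst d) * fact (snd d))) R z p)
      - (\<Sum>n<R. graph_coeff \<Lambda> n / z ^ n)\<bar> \<le> K / z ^ R"
proof -
  let ?c = "\<lambda>d. \<Lambda> d / (fact (fst d) * fact (snd d))"
  let ?U = "\<lambda>m f. \<Sum>i<m. fst ((f :: nat \<Rightarrow> nat \<times> nat) i)" and ?W = "\<lambda>m f. \<Sum>i<m. snd ((f :: nat \<Rightarrow> nat \<times> nat) i)"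
  define t where "t = (\<lambda>p. family_term ?c (fst p) (snd p))"
  define ord where "ord = (\<lambda>p. family_order (fst p) (snd p))"
  define A where "A = {p \<in> families R. ord p < R}"
  define B where "B = {p \<in> families R. \<not> ord p < R}"
  define K where "K = (\<Sum>p\<in>B. \<bar>t p\<bar>)"
  have "\<bar>z / (2 * pi) * (LINT p|lebesgue. gaussian_approx ?c R z p) - (\<Sum>n<R. graph_coeff \<Lambda> n / z ^ n)\<bar> \<le> K / z ^ R"
    if z: "z \<ge> 1" for z
  proof -
    have z0: "z > 0" using z by simp
    have "z / (2 * pi) * (LINT p|lebesgue. gaussian_approx ?c R z p) =
      (\<Sum>m<2 * R. \<Sum>f\<in>{..<m} \<rightarrow>\<^sub>E degrees_below (2 * R + 2). family_term ?c m f * (z ^ m / z ^ ((?U m f + ?W m f) div 2)))"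
      using gaussian_approx_integral[OF z0, of ?c R] z0
      by (simp only: has_bochner_integral_iff family_term_def) simp
    also have "\<dots> = (\<Sum>(m, f)\<in>families R. family_term ?c m f * (z ^ m / z ^ ((?U m f + ?W m f) div 2)))"
      unfolding families_def by (intro sum.Sigma) (auto intro!: finite_PiE finite_degrees_below)
    also have "\<dots> = (\<Sum>p\<in>families R. t p / z ^ ord p)"
    proof (intro sum.cong refl)
      fix p assume "p \<in> families R"
      then obtain m f where pf: "p = (m, f)" and f: "f \<in> {..<m} \<rightarrow>\<^sub>E degrees_below (2 * R + 2)"
        by (auto simp: families_def)
      have "3 * m \<le> ?U m f + ?W m f" using f by (intro degree_sum_ge) (auto simp: degrees_below_def)
      then have "(?U m f + ?W m f) div 2 = m + family_order m f" by (simp add: family_order_def)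
      then show "(case p of (m, f) \<Rightarrow> family_term ?c m f * (z ^ m / z ^ ((?U m f + ?W m f) div 2))) = t p / z ^ ord p"
        using z0 by (simp add: pf t_def ord_def power_add)
    qed
    also have "\<dots> = (\<Sum>p\<in>A. t p / z ^ ord p) + (\<Sum>p\<in>B. t p / z ^ ord p)"
      unfolding A_def B_def by (rule sum.Int_Diff[OF finite_families, of _ _ "{p. ord p < R}", THEN trans])
        (auto simp: Int_def set_diff_eq)
    also have "(\<Sum>p\<in>A. t p / z ^ ord p) = (\<Sum>n<R. \<Sum>p\<in>{p\<in>A. ord p = n}. t p / z ^ ord p)"
      by (rule sum.group[symmetric]) (auto simp: A_def finite_families)
    also have "\<dots> = (\<Sum>n<R. graph_coeff \<Lambda> n / z ^ n)"
    proof (intro sum.cong refl)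
      fix n assume n: "n \<in> {..<R}"
      have "graph_coeff \<Lambda> n = (\<Sum>p\<in>{p\<in>A. ord p = n}. t p)"
        using n by (subst graph_coeff_eq_sum_families[of n R])
          (auto simp: t_def ord_def A_def split_beta' intro!: sum.cong)
      then show "(\<Sum>p\<in>{p\<in>A. ord p = n}. t p / z ^ ord p) = graph_coeff \<Lambda> n / z ^ n"
        by (simp add: sum_divide_distrib)
    qed
    finally have "\<bar>z / (2 * pi) * (LINT p|lebesgue. gaussian_approx ?c R z p) - (\<Sum>n<R. graph_coeff \<Lambda> n / z ^ n)\<bar>
      = \<bar>\<Sum>p\<in>B. t p / z ^ ord p\<bar>" by simp
    also have "\<dots> \<le> (\<Sum>p\<in>B. \<bar>t p / z ^ ord p\<bar>)" by (rule sum_abs)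
    also have "\<dots> \<le> (\<Sum>p\<in>B. \<bar>t p\<bar> / z ^ R)"
    proof (rule sum_mono)
      fix p assume "p \<in> B"
      then have "z ^ R \<le> z ^ ord p" using z by (intro power_increasing) (auto simp: B_def)
      then show "\<bar>t p / z ^ ord p\<bar> \<le> \<bar>t p\<bar> / z ^ R" using z0 by (simp add: abs_divide divide_left_mono)
    qed
    also have "\<dots> = K / z ^ R" by (simp add: K_def sum_divide_distrib)
    finally show ?thesis .
  qed
  then show ?thesis by (rule that)
qed

theorem theorem3p8:
  fixes D :: "(real \<times> real) set"
    and g :: "real \<times> real \<Rightarrow> real"
    and \<Lambda> :: "nat \<times> nat \<Rightarrow> real"
  assumes exists: "\<And>z. z > 0 \<Longrightarrow> set_integrable lebesgue D (\<lambda>p. exp (z * g p))"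
    and neighborhood: "(0, 0) \<in> interior D"
    and supremum: "attains_unique_supremum_at g D (0, 0)"
    and expansion: "\<forall>\<^sub>F (x, y) in nhds (0, 0).
      ((\<lambda>(u, w). \<Lambda> (u, w) * (x ^ u * y ^ w) / (fact u * fact w))
         has_sum (g (x, y) - (- x\<^sup>2 / 2 - y\<^sup>2 / 2))) {(u, w). u + w \<ge> 3}"
  shows "has_asymptotic_expansion (laplace_integral D g) (graph_coeff \<Lambda>)"
  unfolding has_asymptotic_expansion_def
proof
  fix R
  let ?c = "\<lambda>d. \<Lambda> d / (fact (fst d) * fact (snd d))"
  have zero: "(0, 0) = (0 :: real \<times> real)" by (simp add: zero_prod_def)
  have ev: "\<forall>\<^sub>F p in nhds (0 :: real \<times> real).
      ((\<lambda>d. ?c d * (fst p ^ fst d * snd p ^ snd d)) has_sum (g p + (norm p)\<^sup>2 / 2)) {d. 3 \<le> fst d + snd d}"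
    using expansion unfolding zero
  proof eventually_elim
    case (elim p)
    obtain x y where p: "p = (x, y)" by fastforce
    have "g (x, y) - (- x\<^sup>2 / 2 - y\<^sup>2 / 2) = g p + (norm p)\<^sup>2 / 2"
      by (simp add: p norm_prod_sq add_divide_distrib)
    moreover have "(\<lambda>(u, w). \<Lambda> (u, w) * (x ^ u * y ^ w) / (fact u * fact w)) =
        (\<lambda>d. ?c d * (fst p ^ fst d * snd p ^ snd d))"
      by (auto simp: p fun_eq_iff)
    moreover have "{(u :: nat, w). u + w \<ge> 3} = {d. 3 \<le> fst d + snd d}" by auto
    ultimately show ?case using elim unfolding p prod.case by (simp only:)
  qed
  obtain K1 where K1: "\<And>z. z \<ge> 1 \<Longrightarrow>
    \<bar>laplace_integral D g z - z / (2 * pi) * (LINT p|lebesgue. gaussian_approx ?c R z p)\<bar> \<le> K1 / z ^ R"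
    using laplace_remainder[OF exists neighborhood[unfolded zero] supremum[unfolded zero] ev, of R] by blast
  obtain K2 where K2: "\<And>z. z \<ge> 1 \<Longrightarrow>
    \<bar>z / (2 * pi) * (LINT p|lebesgue. gaussian_approx ?c R z p) - (\<Sum>n<R. graph_coeff \<Lambda> n / z ^ n)\<bar> \<le> K2 / z ^ R"
    using gaussian_approx_expansion[of \<Lambda> R] by blast
  show "(\<lambda>z. laplace_integral D g z - (\<Sum>n<R. graph_coeff \<Lambda> n * z powi (- int n)))
    \<in> O[at_top](\<lambda>z. z powi (- int R))"
  proof (rule bigoI)
    show "\<forall>\<^sub>F z in at_top. norm (laplace_integral D g z - (\<Sum>n<R. graph_coeff \<Lambda> n * z powi (- int n)))
      \<le> (K1 + K2) * norm (z powi (- int R))"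
      using eventually_ge_at_top[of 1]
    proof eventually_elim
      case (elim z)
      have "\<bar>laplace_integral D g z - (\<Sum>n<R. graph_coeff \<Lambda> n / z ^ n)\<bar> \<le> K1 / z ^ R + K2 / z ^ R"
        using K1[OF elim] K2[OF elim] by linarith
      then show ?case using elim
        by (simp add: power_int_minus divide_inverse distrib_right)
    qed
  qed
qed

end
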